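(* Let $n\ge 1$ be an integer, let $T$ be a locally compact Hausdorff space, let $A$ be an $n$-homogeneous C*-algebra over $T$, i.e. the C*-algebra of continuous sections of a C*-bundle $\mathcal A$ over $T$ with fibre $M_n$, and let $B$ be a Cartan subalgebra of $A$, i.e. the C*-algebra of continuous sections of a sub-C*-bundle $\mathcal B$ of $\mathcal A$ over $T$ with fibre $D_n$. Then there exists a local trivialization for $(\mathcal A,\mathcal B)$: for every $t\in T$, there exists a neighbourhood $W$ of $t$ and an isomorphism of C*-bundles $\mathcal A|_W \cong W\times M_n$ which identifies $\mathcal B|_W$ with $W\times D_n$.
   Context: $M_n=M_n(\mathbb C)$, and $D_n\subseteq M_n$ is the subalgebra of diagonal matrices, which is the unique Cartan subalgebra of $M_n$ up to conjugacy. Sections are understood to vanish at infinity. It is known that $\mathcal A$ is automatically locally trivial, and that a Cartan subalgebra $B$ of $A$ is the algebra of continuous sections of a sub-C*-bundle $\mathcal B$ of $\mathcal A$ over $T$ whose fibre at each $t\in T$ is a Cartan subalgebra of $\mathcal A_t\cong M_n$ (so isomorphic to $D_n$). A Cartan subalgebra of a C*-algebra $A$ is an abelian sub-C*-algebra $B \subseteq A$ such that (1) $B$ contains an approximate unit of $A$; (2) $B$ is maximal abelian in $A$; (3) $B$ is regular, i.e. $N_A(B)=\{n\in A : nBn^*\subseteq B \text{ and } n^*Bn\subseteq B\}$ generates $A$ as a C*-algebra; (4) there exists a faithful conditional expectation of $A$ onto $B$. *)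

theory Defs
  imports "HOL-Analysis.Analysis"
begin

section \<open>C*-algebras\<close>

record 'a star_alg =
  carr :: "'a set"
  add :: "'a \<Rightarrow> 'a \<Rightarrow> 'a"  (infixl "\<oplus>\<index>" 65)
  zero :: "'a"  ("\<zero>\<index>")
  smul :: "complex \<Rightarrow> 'a \<Rightarrow> 'a"  (infixr "\<odot>\<index>" 75)
  mul :: "'a \<Rightarrow> 'a \<Rightarrow> 'a"  (infixl "\<otimes>\<index>" 70)
  involution :: "'a \<Rightarrow> 'a"  ("adj\<index>")
  cnorm :: "'a \<Rightarrow> real"  ("nrm\<index>")

definition sub :: "('a, 'b) star_alg_scheme \<Rightarrow> 'a \<Rightarrow> 'a \<Rightarrow> 'a"  (infixl "\<ominus>\<index>" 65)
  where "x \<ominus>\<^bsub>A\<^esub> y = x \<oplus>\<^bsub>A\<^esub> (- 1) \<odot>\<^bsub>A\<^esub> y"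

text \<open>C*-algebras are not assumed to be unital.\<close>

locale cstar_algebra =
  fixes A :: "'a star_alg" (structure)
  assumes zero_closed: "\<zero> \<in> carr A"
    and add_closed: "\<lbrakk>x \<in> carr A; y \<in> carr A\<rbrakk> \<Longrightarrow> x \<oplus> y \<in> carr A"
    and smul_closed: "x \<in> carr A \<Longrightarrow> c \<odot> x \<in> carr A"
    and mul_closed: "\<lbrakk>x \<in> carr A; y \<in> carr A\<rbrakk> \<Longrightarrow> x \<otimes> y \<in> carr A"
    and adj_closed: "x \<in> carr A \<Longrightarrow> adj x \<in> carr A"
    and add_assoc: "\<lbrakk>x \<in> carr A; y \<in> carr A; z \<in> carr A\<rbrakk> \<Longrightarrow> (x \<oplus> y) \<oplus> z = x \<oplus> (y \<oplus> z)"
    and add_commute: "\<lbrakk>x \<in> carr A; y \<in> carr A\<rbrakk> \<Longrightarrow> x \<oplus> y = y \<oplus> x"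
    and add_zero: "x \<in> carr A \<Longrightarrow> x \<oplus> \<zero> = x"
    and sub_self: "x \<in> carr A \<Longrightarrow> x \<ominus> x = \<zero>"
    and smul_add: "\<lbrakk>x \<in> carr A; y \<in> carr A\<rbrakk> \<Longrightarrow> c \<odot> (x \<oplus> y) = c \<odot> x \<oplus> c \<odot> y"
    and add_smul: "x \<in> carr A \<Longrightarrow> (c + d) \<odot> x = c \<odot> x \<oplus> d \<odot> x"
    and smul_smul: "x \<in> carr A \<Longrightarrow> c \<odot> (d \<odot> x) = (c * d) \<odot> x"
    and one_smul: "x \<in> carr A \<Longrightarrow> 1 \<odot> x = x"
    and mul_assoc: "\<lbrakk>x \<in> carr A; y \<in> carr A; z \<in> carr A\<rbrakk> \<Longrightarrow> (x \<otimes> y) \<otimes> z = x \<otimes> (y \<otimes> z)"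
    and mul_add: "\<lbrakk>x \<in> carr A; y \<in> carr A; z \<in> carr A\<rbrakk> \<Longrightarrow> x \<otimes> (y \<oplus> z) = x \<otimes> y \<oplus> x \<otimes> z"
    and add_mul: "\<lbrakk>x \<in> carr A; y \<in> carr A; z \<in> carr A\<rbrakk> \<Longrightarrow> (x \<oplus> y) \<otimes> z = x \<otimes> z \<oplus> y \<otimes> z"
    and smul_mul: "\<lbrakk>x \<in> carr A; y \<in> carr A\<rbrakk> \<Longrightarrow> (c \<odot> x) \<otimes> y = c \<odot> (x \<otimes> y)"
    and mul_smul: "\<lbrakk>x \<in> carr A; y \<in> carr A\<rbrakk> \<Longrightarrow> x \<otimes> (c \<odot> y) = c \<odot> (x \<otimes> y)"
    and adj_adj: "x \<in> carr A \<Longrightarrow> adj (adj x) = x"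
    and adj_add: "\<lbrakk>x \<in> carr A; y \<in> carr A\<rbrakk> \<Longrightarrow> adj (x \<oplus> y) = adj x \<oplus> adj y"
    and adj_smul: "x \<in> carr A \<Longrightarrow> adj (c \<odot> x) = cnj c \<odot> adj x"
    and adj_mul: "\<lbrakk>x \<in> carr A; y \<in> carr A\<rbrakk> \<Longrightarrow> adj (x \<otimes> y) = adj y \<otimes> adj x"
    and nrm_nonneg: "x \<in> carr A \<Longrightarrow> 0 \<le> nrm x"
    and nrm_eq_zero: "x \<in> carr A \<Longrightarrow> nrm x = 0 \<longleftrightarrow> x = \<zero>"
    and nrm_add: "\<lbrakk>x \<in> carr A; y \<in> carr A\<rbrakk> \<Longrightarrow> nrm (x \<oplus> y) \<le> nrm x + nrm y"
    and nrm_smul: "x \<in> carr A \<Longrightarrow> nrm (c \<odot> x) = cmod c * nrm x"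
    and nrm_mul: "\<lbrakk>x \<in> carr A; y \<in> carr A\<rbrakk> \<Longrightarrow> nrm (x \<otimes> y) \<le> nrm x * nrm y"
    and cstar_identity: "x \<in> carr A \<Longrightarrow> nrm (adj x \<otimes> x) = (nrm x)\<^sup>2"
    and complete: "\<lbrakk>\<And>k. s k \<in> carr A;
        \<And>e. 0 < e \<Longrightarrow> \<exists>N. \<forall>j\<ge>N. \<forall>k\<ge>N. nrm (s j \<ominus> s k) < e\<rbrakk>
      \<Longrightarrow> \<exists>x\<in>carr A. (\<lambda>k. nrm (s k \<ominus> x)) \<longlonglongrightarrow> 0"

definition star_iso :: "'a star_alg \<Rightarrow> 'c star_alg \<Rightarrow> ('a \<Rightarrow> 'c) \<Rightarrow> bool" where
  "star_iso A C h \<longleftrightarrow> bij_betw h (carr A) (carr C) \<and>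
     (\<forall>x\<in>carr A. \<forall>y\<in>carr A. h (x \<oplus>\<^bsub>A\<^esub> y) = h x \<oplus>\<^bsub>C\<^esub> h y) \<and>
     (\<forall>c. \<forall>x\<in>carr A. h (c \<odot>\<^bsub>A\<^esub> x) = c \<odot>\<^bsub>C\<^esub> h x) \<and>
     (\<forall>x\<in>carr A. \<forall>y\<in>carr A. h (x \<otimes>\<^bsub>A\<^esub> y) = h x \<otimes>\<^bsub>C\<^esub> h y) \<and>
     (\<forall>x\<in>carr A. h (adj\<^bsub>A\<^esub> x) = adj\<^bsub>C\<^esub> (h x))"

definition star_isomorphic :: "'a star_alg \<Rightarrow> 'c star_alg \<Rightarrow> bool" where
  "star_isomorphic A C \<longleftrightarrow> (\<exists>h. star_iso A C h)"

text \<open>Completeness makes a C*-subalgebra norm-closed.\<close>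

definition cstar_subalgebra :: "'a star_alg \<Rightarrow> 'a set \<Rightarrow> bool" where
  "cstar_subalgebra A B \<longleftrightarrow> B \<subseteq> carr A \<and> cstar_algebra (A\<lparr>carr := B\<rparr>)"

text \<open>
  The norm of \<open>matrix_alg\<close> is the operator norm for the Hermitian norm on \<open>\<complex>\<^sup>n\<close>, not the
  (Frobenius) norm of the type \<^typ>\<open>complex^'n^'n\<close>; both induce the same topology.
\<close>

definition matrix_alg :: "(complex^'n^'n) star_alg" where
  "matrix_alg = \<lparr>carr = UNIV, add = (+), zero = 0,
     smul = (\<lambda>c M. \<chi> i j. c * M $ i $ j), mul = (**),
     involution = (\<lambda>M. \<chi> i j. cnj (M $ j $ i)), cnorm = (\<lambda>M. onorm (\<lambda>v. M *v v))\<rparr>"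

definition diagonal :: "(complex^'n^'n) set" where
  "diagonal = {M. \<forall>i j. i \<noteq> j \<longrightarrow> M $ i $ j = 0}"

definition diagonal_alg :: "(complex^'n^'n) star_alg" where
  "diagonal_alg = matrix_alg\<lparr>carr := diagonal\<rparr>"


section \<open>Cartan subalgebras\<close>

definition abelian :: "'a star_alg \<Rightarrow> 'a set \<Rightarrow> bool" where
  "abelian A B \<longleftrightarrow> (\<forall>x\<in>B. \<forall>y\<in>B. x \<otimes>\<^bsub>A\<^esub> y = y \<otimes>\<^bsub>A\<^esub> x)"

definition positive_in :: "'a star_alg \<Rightarrow> 'a \<Rightarrow> bool" where
  "positive_in A x \<longleftrightarrow> (\<exists>y\<in>carr A. x = adj\<^bsub>A\<^esub> y \<otimes>\<^bsub>A\<^esub> y)"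

text \<open>
  An approximate unit is a net of positive contractions; the net is represented by the
  filter \<open>F\<close> on the algebra that it generates.
\<close>

definition contains_approximate_unit :: "'a star_alg \<Rightarrow> 'a set \<Rightarrow> bool" where
  "contains_approximate_unit A B \<longleftrightarrow>
     (\<exists>F. F \<noteq> bot \<and> (\<forall>\<^sub>F u in F. u \<in> B \<and> positive_in A u \<and> nrm\<^bsub>A\<^esub> u \<le> 1) \<and>
        (\<forall>a\<in>carr A. ((\<lambda>u. nrm\<^bsub>A\<^esub> (u \<otimes>\<^bsub>A\<^esub> a \<ominus>\<^bsub>A\<^esub> a)) \<longlongrightarrow> 0) F \<and>
                     ((\<lambda>u. nrm\<^bsub>A\<^esub> (a \<otimes>\<^bsub>A\<^esub> u \<ominus>\<^bsub>A\<^esub> a)) \<longlongrightarrow> 0) F))"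

definition maximal_abelian :: "'a star_alg \<Rightarrow> 'a set \<Rightarrow> bool" where
  "maximal_abelian A B \<longleftrightarrow> cstar_subalgebra A B \<and> abelian A B \<and>
     (\<forall>C. cstar_subalgebra A C \<and> abelian A C \<and> B \<subseteq> C \<longrightarrow> C = B)"

definition normalizer :: "'a star_alg \<Rightarrow> 'a set \<Rightarrow> 'a set" where
  "normalizer A B = {n \<in> carr A.
     (\<forall>b\<in>B. n \<otimes>\<^bsub>A\<^esub> b \<otimes>\<^bsub>A\<^esub> adj\<^bsub>A\<^esub> n \<in> B) \<and> (\<forall>b\<in>B. adj\<^bsub>A\<^esub> n \<otimes>\<^bsub>A\<^esub> b \<otimes>\<^bsub>A\<^esub> n \<in> B)}"

definition generated_subalgebra :: "'a star_alg \<Rightarrow> 'a set \<Rightarrow> 'a set" where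
  "generated_subalgebra A X = \<Inter>{C. cstar_subalgebra A C \<and> X \<subseteq> C}"

definition conditional_expectation :: "'a star_alg \<Rightarrow> 'a set \<Rightarrow> ('a \<Rightarrow> 'a) \<Rightarrow> bool" where
  "conditional_expectation A B E \<longleftrightarrow>
     (\<forall>a\<in>carr A. E a \<in> B) \<and> (\<forall>b\<in>B. E b = b) \<and>
     (\<forall>a\<in>carr A. \<forall>a'\<in>carr A. E (a \<oplus>\<^bsub>A\<^esub> a') = E a \<oplus>\<^bsub>A\<^esub> E a') \<and>
     (\<forall>c. \<forall>a\<in>carr A. E (c \<odot>\<^bsub>A\<^esub> a) = c \<odot>\<^bsub>A\<^esub> E a) \<and>
     (\<forall>a\<in>carr A. positive_in A a \<longrightarrow> positive_in A (E a)) \<and>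
     (\<forall>a\<in>carr A. nrm\<^bsub>A\<^esub> (E a) \<le> nrm\<^bsub>A\<^esub> a) \<and>
     (\<forall>a\<in>carr A. \<forall>b\<in>B. \<forall>b'\<in>B. E (b \<otimes>\<^bsub>A\<^esub> a \<otimes>\<^bsub>A\<^esub> b') = b \<otimes>\<^bsub>A\<^esub> E a \<otimes>\<^bsub>A\<^esub> b')"

definition faithful :: "'a star_alg \<Rightarrow> ('a \<Rightarrow> 'a) \<Rightarrow> bool" where
  "faithful A E \<longleftrightarrow> (\<forall>a\<in>carr A. E (adj\<^bsub>A\<^esub> a \<otimes>\<^bsub>A\<^esub> a) = \<zero>\<^bsub>A\<^esub> \<longrightarrow> a = \<zero>\<^bsub>A\<^esub>)"

definition cartan_subalgebra :: "'a star_alg \<Rightarrow> 'a set \<Rightarrow> bool" where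
  "cartan_subalgebra A B \<longleftrightarrow>
     cstar_subalgebra A B \<and> abelian A B \<and>
     contains_approximate_unit A B \<and>
     maximal_abelian A B \<and>
     generated_subalgebra A (normalizer A B) = carr A \<and>
     (\<exists>E. conditional_expectation A B E \<and> faithful A E)"


section \<open>C*-bundles\<close>

text \<open>
  The operations of all fibres are given by functions on the total space, which are meaningful
  on pairs of points of the same fibre only.
\<close>

record ('t, 'e) star_bundle =
  base :: "'t topology"
  total :: "'e topology"
  proj :: "'e \<Rightarrow> 't"
  badd :: "'e \<Rightarrow> 'e \<Rightarrow> 'e"
  bzero :: "'t \<Rightarrow> 'e"
  bsmul :: "complex \<Rightarrow> 'e \<Rightarrow> 'e"
  bmul :: "'e \<Rightarrow> 'e \<Rightarrow> 'e"
  badj :: "'e \<Rightarrow> 'e"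
  bnrm :: "'e \<Rightarrow> real"

definition fibre :: "('t, 'e) star_bundle \<Rightarrow> 't \<Rightarrow> 'e star_alg" where
  "fibre E t = \<lparr>carr = {x \<in> topspace (total E). proj E x = t}, add = badd E, zero = bzero E t,
     smul = bsmul E, mul = bmul E, involution = badj E, cnorm = bnrm E\<rparr>"

definition fibre_product :: "('t, 'e) star_bundle \<Rightarrow> ('e \<times> 'e) topology" where
  "fibre_product E =
     subtopology (prod_topology (total E) (total E)) {(x, y). proj E x = proj E y}"

text \<open>
  C*-bundles in the sense of Fell and Doran, with continuous norm; no local triviality is
  required. The last axiom says that a net of points whose norms tend to 0 and whose
  projections tend to \<open>t\<close> converges to the zero of the fibre over \<open>t\<close>.
\<close>

locale cstar_bundle =
  fixes E :: "('t, 'e) star_bundle"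
  assumes proj_continuous: "continuous_map (total E) (base E) (proj E)"
    and proj_open: "open_map (total E) (base E) (proj E)"
    and proj_surj: "proj E ` topspace (total E) = topspace (base E)"
    and fibre_cstar: "t \<in> topspace (base E) \<Longrightarrow> cstar_algebra (fibre E t)"
    and add_continuous: "continuous_map (fibre_product E) (total E) (\<lambda>(x, y). badd E x y)"
    and smul_continuous:
      "continuous_map (prod_topology euclidean (total E)) (total E) (\<lambda>(c, x). bsmul E c x)"
    and mul_continuous: "continuous_map (fibre_product E) (total E) (\<lambda>(x, y). bmul E x y)"
    and adj_continuous: "continuous_map (total E) (total E) (badj E)"
    and nrm_continuous: "continuous_map (total E) euclideanreal (bnrm E)"
    and zero_neighbourhood: "\<lbrakk>t \<in> topspace (base E); openin (total E) V; bzero E t \<in> V\<rbrakk>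
      \<Longrightarrow> \<exists>U e. openin (base E) U \<and> t \<in> U \<and> 0 < e \<and>
            {x \<in> topspace (total E). proj E x \<in> U \<and> bnrm E x < e} \<subseteq> V"

definition subbundle :: "('t, 'e) star_bundle \<Rightarrow> 'e set \<Rightarrow> ('t, 'e) star_bundle" where
  "subbundle E S = E\<lparr>total := subtopology (total E) S\<rparr>"

definition sub_cstar_bundle :: "('t, 'e) star_bundle \<Rightarrow> 'e set \<Rightarrow> bool" where
  "sub_cstar_bundle E S \<longleftrightarrow> S \<subseteq> topspace (total E) \<and> cstar_bundle (subbundle E S)"

definition bundle_restrict :: "('t, 'e) star_bundle \<Rightarrow> 't set \<Rightarrow> ('t, 'e) star_bundle" where
  "bundle_restrict E W = E\<lparr>base := subtopology (base E) W,
     total := subtopology (total E) {x. proj E x \<in> W}\<rparr>"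

definition trivial_bundle ::
    "'t topology \<Rightarrow> ('m::topological_space) star_alg \<Rightarrow> ('t, 't \<times> 'm) star_bundle" where
  "trivial_bundle X M =
     \<lparr>base = X, total = prod_topology X (top_of_set (carr M)), proj = fst,
      badd = (\<lambda>(t, x) (s, y). (t, x \<oplus>\<^bsub>M\<^esub> y)), bzero = (\<lambda>t. (t, \<zero>\<^bsub>M\<^esub>)),
      bsmul = (\<lambda>c (t, x). (t, c \<odot>\<^bsub>M\<^esub> x)), bmul = (\<lambda>(t, x) (s, y). (t, x \<otimes>\<^bsub>M\<^esub> y)),
      badj = (\<lambda>(t, x). (t, adj\<^bsub>M\<^esub> x)), bnrm = (\<lambda>(t, x). nrm\<^bsub>M\<^esub> x)\<rparr>"

definition bundle_iso :: "('t, 'e) star_bundle \<Rightarrow> ('t, 'f) star_bundle \<Rightarrow> ('e \<Rightarrow> 'f) \<Rightarrow> bool" where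
  "bundle_iso E F \<phi> \<longleftrightarrow> base E = base F \<and>
     homeomorphic_map (total E) (total F) \<phi> \<and>
     (\<forall>x\<in>topspace (total E). proj F (\<phi> x) = proj E x) \<and>
     (\<forall>t\<in>topspace (base E). star_iso (fibre E t) (fibre F t) \<phi>)"


section \<open>The C*-algebra of continuous sections vanishing at infinity\<close>

text \<open>
  Sections are extensional functions on the base, so that they are determined by their values
  there. Inserting 0 into the supremum only matters for the empty base.
\<close>

definition sections :: "('t, 'e) star_bundle \<Rightarrow> ('t \<Rightarrow> 'e) set" where
  "sections E = {f \<in> extensional (topspace (base E)).
     continuous_map (base E) (total E) f \<and>
     (\<forall>t\<in>topspace (base E). proj E (f t) = t) \<and>
     (\<forall>e>0. \<exists>K. compactin (base E) K \<and> (\<forall>t\<in>topspace (base E) - K. bnrm E (f t) < e))}"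

definition section_alg :: "('t, 'e) star_bundle \<Rightarrow> ('t \<Rightarrow> 'e) star_alg" where
  "section_alg E =
     \<lparr>carr = sections E,
      add = (\<lambda>f g. \<lambda>t\<in>topspace (base E). badd E (f t) (g t)),
      zero = (\<lambda>t\<in>topspace (base E). bzero E t),
      smul = (\<lambda>c f. \<lambda>t\<in>topspace (base E). bsmul E c (f t)),
      mul = (\<lambda>f g. \<lambda>t\<in>topspace (base E). bmul E (f t) (g t)),
      involution = (\<lambda>f. \<lambda>t\<in>topspace (base E). badj E (f t)),
      cnorm = (\<lambda>f. Sup (insert 0 ((\<lambda>t. bnrm E (f t)) ` topspace (base E))))\<rparr>"

end

theory Submission
  imports Defs
begin

text \<open>
  Fibrewise the pair is unitarily equivalent to \<open>(M\<^sub>n, D\<^sub>n)\<close>, so only continuity is at stake.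
  The bundle projection is open on \<open>\<B>\<close>, hence an idempotent of \<open>\<B>\<^sub>t\<close> has idempotents of
  \<open>\<B>\<^sub>s\<close> near it for \<open>s\<close> near \<open>t\<close>; these are unique, because distinct idempotents of a
  commutative C*-algebra have distance at least 1, and therefore form continuous sections
  \<open>q\<^sub>1, ..., q\<^sub>n\<close>. The unit vectors of the line bundle \<open>q\<^sub>i \<A> q\<^sub>j\<close> form a free circle bundle
  over a locally compact Hausdorff space, which has local sections by Gleason's averaging
  argument. Such sections are matrix units and trivialize \<open>\<A>\<close>.
\<close>

section \<open>Local sections of free circle actions\<close>

text \<open>The isomorphisms of the fibres with the matrix algebra are chosen point by point and
  carry no topology: they may jump from point to point, and \<open>star_iso\<close> does not mention
  norms. All continuity has to come from the bundle operations, the bundle norm and the openness of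
  the projections. Norms and matrix entries are linked by the C*-identity alone, which gives every
  matrix unit norm 1. Once the idempotents have become the diagonal matrix units, the frame of a
  fibre is determined up to a diagonal unitary, since the corner between two of them is a complex
  line. Phases chosen freely are as discontinuous as frames; this is why sections of circle bundles
  are needed. Gleason's argument extends a function from one orbit by Tietze's theorem, so it is run
  over a compact neighbourhood in the base, where the circle bundle is compact. One column of matrix
  units suffices: if \<open>w i\<close> is sent to the unit at (i, o'), then \<open>w i\<close>
  times the adjoint of \<open>w j\<close> is sent to the unit at (i, j).\<close>

lemma integral_shift_periodic:
  fixes g :: "real \<Rightarrow> 'a::euclidean_space"
  assumes cont: "continuous_on UNIV g" and per: "\<And>x. g (x + p) = g x" and a: "0 \<le> a" "a \<le> p"
  shows "integral {0..p} (\<lambda>x. g (x + a)) = integral {0..p} g"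
proof -
  have sub: "continuous_on S g" for S
    using cont continuous_on_subset by blast
  then have int: "g integrable_on {c..d}" for c d
    by (simp add: integrable_continuous_interval)
  \<comment> \<open>The window from \<open>a\<close> to \<open>p + a\<close> is cut at
    \<open>p\<close>, and the piece beyond \<open>p\<close> is moved back by one period. The bounds
    on \<open>a\<close> put the cut inside the window.\<close>
  have "integral {0..p} (\<lambda>x. g (x + a)) = integral {a..p + a} g"
    using integral_shift[where a=0 and c=a and b=p, OF sub] by (simp add: o_def)
  also have "\<dots> = integral {a..p} g + integral {p..p + a} g"
    using a by (intro Henstock_Kurzweil_Integration.integral_combine[symmetric] int) auto
  also have "integral {p..p + a} g = integral {0..a} g"
    using integral_shift[where a=0 and c=p and b=a, OF sub] by (simp add: o_def per add.commute)
  also have "integral {a..p} g + integral {0..a} g = integral {0..p} g"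
    using Henstock_Kurzweil_Integration.integral_combine[OF a int] by (simp add: add.commute)
  finally show ?thesis .
qed

text \<open>All laws are restricted to scalars of modulus 1. In the application \<open>act\<close>
  is the scalar multiplication of the bundle, which leaves the circle bundle for any other
  modulus.\<close>

locale circle_action =
  fixes P :: "'p topology" and act :: "complex \<Rightarrow> 'p \<Rightarrow> 'p"  (infixr "\<bullet>\<^sub>c" 75)
  assumes act_continuous:
      "continuous_map (prod_topology (top_of_set (sphere 0 1)) P) P (\<lambda>(c, x). c \<bullet>\<^sub>c x)"
    and act_act: "\<lbrakk>cmod c = 1; cmod d = 1; x \<in> topspace P\<rbrakk> \<Longrightarrow> c \<bullet>\<^sub>c d \<bullet>\<^sub>c x = (c * d) \<bullet>\<^sub>c x"
    and act_one: "x \<in> topspace P \<Longrightarrow> 1 \<bullet>\<^sub>c x = x"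
begin

lemma act_closed: "\<lbrakk>cmod c = 1; x \<in> topspace P\<rbrakk> \<Longrightarrow> c \<bullet>\<^sub>c x \<in> topspace P"
  using continuous_map_funspace[OF act_continuous] by (auto simp: Pi_iff)

lemma continuous_map_act:
  assumes "continuous_map X euclidean c" "continuous_map X P f" "\<And>x. x \<in> topspace X \<Longrightarrow> cmod (c x) = 1"
  shows "continuous_map X P (\<lambda>x. c x \<bullet>\<^sub>c f x)"
proof -
  have "continuous_map X (prod_topology (top_of_set (sphere 0 1)) P) (\<lambda>x. (c x, f x))"
    using assms by (auto simp: continuous_map_paired continuous_map_in_subtopology)
  from continuous_map_compose[OF this act_continuous] show ?thesis
    by (simp add: o_def)
qed

text \<open>Compactness of the circle makes a neighbourhood uniform in the group element. This later
  shows that the orbit projection is closed.\<close>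

lemma act_tube:
  assumes U: "openin P U" and x: "x \<in> topspace P" and orbit: "\<And>c. cmod c = 1 \<Longrightarrow> c \<bullet>\<^sub>c x \<in> U"
  obtains V where "openin P V" "x \<in> V" "\<And>c z. \<lbrakk>cmod c = 1; z \<in> V\<rbrakk> \<Longrightarrow> c \<bullet>\<^sub>c z \<in> U"
proof -
  let ?S = "top_of_set (sphere (0::complex) 1)"
  let ?W = "{p \<in> topspace (prod_topology ?S P). (case p of (c, x) \<Rightarrow> c \<bullet>\<^sub>c x) \<in> U}"
  have "openin (prod_topology ?S P) ?W"
    by (rule openin_continuous_map_preimage[OF act_continuous U])
  moreover have "compactin ?S (sphere 0 1)"
    using compact_sphere[of "0::complex" 1] by (simp add: compactin_subtopology)
  moreover have "sphere 0 1 \<times> {x} \<subseteq> ?W"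
    using x orbit by auto
  ultimately have "\<exists>A V. openin ?S A \<and> openin P V \<and> sphere 0 1 \<subseteq> A \<and> x \<in> V \<and> A \<times> V \<subseteq> ?W"
    by (intro tube_lemma_left x)
  then obtain A V where V: "openin P V" "sphere 0 1 \<subseteq> A" "x \<in> V" "A \<times> V \<subseteq> ?W"
    by blast
  have "c \<bullet>\<^sub>c z \<in> U" if "cmod c = 1" "z \<in> V" for c z
    using that V(2) subsetD[OF V(4), of "(c, z)"] by auto
  then show ?thesis using that V by blast
qed

text \<open>Freeness at \<open>v\<close> and compactness make the orbit of \<open>v\<close> a closed
  homeomorphic copy of the circle. A function on that copy extends to \<open>P\<close> by Tietze's
  theorem, and averaging the extension against a character restores equivariance.\<close>

lemma equivariant_function:
  assumes compact: "compact_space P" and Hausdorff: "Hausdorff_space P"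
    and v: "v \<in> topspace P" and free: "\<And>c. \<lbrakk>cmod c = 1; c \<bullet>\<^sub>c v = v\<rbrakk> \<Longrightarrow> c = 1"
  obtains F :: "'p \<Rightarrow> complex" where "continuous_map P euclidean F"
    "\<And>c x. \<lbrakk>cmod c = 1; x \<in> topspace P\<rbrakk> \<Longrightarrow> F (c \<bullet>\<^sub>c x) = c * F x" "F v \<noteq> 0"
proof -
  let ?S = "top_of_set (sphere (0::complex) 1)"
  let ?O = "(\<lambda>c. c \<bullet>\<^sub>c v) ` sphere 0 1"
  have orb: "continuous_map ?S P (\<lambda>c. c \<bullet>\<^sub>c v)"
    by (rule continuous_map_act) (use v in \<open>auto simp: continuous_map_from_subtopology\<close>)
  have "c = d" if "cmod c = 1" "cmod d = 1" "c \<bullet>\<^sub>c v = d \<bullet>\<^sub>c v" for c d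
  proof -
    have "cmod (inverse d) = 1" "d \<noteq> 0" using that by (auto simp: norm_inverse)
    then have "(inverse d * c) \<bullet>\<^sub>c v = v"
      by (metis act_act act_one left_inverse that v)
    then have "inverse d * c = 1"
      using free \<open>cmod (inverse d) = 1\<close> by (simp add: norm_mult that)
    then show ?thesis using \<open>d \<noteq> 0\<close> by (simp add: field_simps)
  qed
  then have inj: "inj_on (\<lambda>c. c \<bullet>\<^sub>c v) (sphere 0 1)"
    by (auto simp: inj_on_def)
  have cS: "compact_space ?S"
    by (simp add: compact_space_subtopology)
  have "continuous_map (subtopology P ?O) ?S (inv_into (sphere 0 1) (\<lambda>c. c \<bullet>\<^sub>c v))"
    by (rule continuous_inverse_map[OF cS Hausdorff orb]) (use inj in \<open>auto intro!: inv_into_f_f\<close>)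
  \<comment> \<open>Tietze's theorem is used for real functions, so only the real part is extended.
    This is enough because the cosine has a nonzero first Fourier coefficient.\<close>
  then have "continuous_map (subtopology P ?O) euclideanreal (Re \<circ> inv_into (sphere 0 1) (\<lambda>c. c \<bullet>\<^sub>c v))"
    by (intro continuous_map_compose[where X'="euclidean"])
      (auto simp: continuous_map_in_subtopology intro: continuous_intros)
  moreover have "closedin P ?O"
    using image_compactin[OF _ orb, of "sphere 0 1"] cS compactin_imp_closedin[OF Hausdorff]
    by (simp add: compact_space_def)
  moreover have "normal_space P"
    using compact Hausdorff compact_Hausdorff_or_regular_imp_normal_space by blast
  ultimately obtain f where f: "continuous_map P euclideanreal f"
    and f_orb: "\<And>x. x \<in> ?O \<Longrightarrow> f x = (Re \<circ> inv_into (sphere 0 1) (\<lambda>c. c \<bullet>\<^sub>c v)) x"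
    using Tietze_extension_realinterval[of P ?O UNIV] by (metis (lifting) UNIV_I UNIV_not_empty is_interval_univ subset_UNIV)
  have f_act: "f (c \<bullet>\<^sub>c v) = Re c" if "cmod c = 1" for c
    using f_orb[of "c \<bullet>\<^sub>c v"] inv_into_f_f[OF inj] that by auto
  have cis_P: "continuous_map euclideanreal P (\<lambda>t. cis t \<bullet>\<^sub>c x)" if "x \<in> topspace P" for x
    by (rule continuous_map_act) (use that in \<open>auto intro!: continuous_intros\<close>)
  have contg: "continuous_on A (\<lambda>t. cis (- t) * of_real (f (cis t \<bullet>\<^sub>c x)))" if "x \<in> topspace P" for x A
  proof -
    have "continuous_map euclideanreal euclideanreal (f \<circ> (\<lambda>t. cis t \<bullet>\<^sub>c x))"
      by (rule continuous_map_compose[OF cis_P[OF that] f])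
    then have "continuous_on UNIV (\<lambda>t. f (cis t \<bullet>\<^sub>c x))"
      by (simp add: o_def)
    then have "continuous_on A (\<lambda>t. f (cis t \<bullet>\<^sub>c x))"
      using continuous_on_subset by blast
    then show ?thesis by (intro continuous_intros) auto
  qed
  \<comment> \<open>The first Fourier coefficient of \<open>f\<close> along the orbit of
    \<open>x\<close>, up to the factor 2 * pi: rotating \<open>x\<close> shifts the variable and
    multiplies the integral by the rotation.\<close>
  define F where "F x = integral {0..2*pi} (\<lambda>t. cis (- t) * of_real (f (cis t \<bullet>\<^sub>c x)))" for x
  show ?thesis
  proof
    show "F v \<noteq> 0"
    proof -
      have "f (cis t \<bullet>\<^sub>c v) = cos t" for t
        by (simp add: f_act)
      then have "F v = integral {0..2*pi} (\<lambda>t. cis (- t) * of_real (cos t))"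
        unfolding F_def by simp
      moreover have "((\<lambda>t. cis (- t) * of_real (cos t)) has_integral
          (of_real pi :: complex)) {0..2*pi}"
      proof -
        \<comment> \<open>The integrand equals (1 + cis (- 2 * t)) / 2, which explains the
          antiderivative. Its oscillating term agrees at both ends, so pi remains.\<close>
        have "((\<lambda>t. cis (- t) * of_real (cos t)) has_integral
            ((of_real (2*pi) / 2 + \<i> * cis (- 2 * (2*pi)) / 4) - (of_real 0 / 2 + \<i> * cis (- 2 * 0) / 4))) {0..2*pi}"
        proof (rule fundamental_theorem_of_calculus)
          fix t :: real
          have "((\<lambda>t. of_real t / 2 + \<i> * cis (- 2 * t) / 4) has_vector_derivative
             (of_real 1 / 2 + \<i> * ((-2) *\<^sub>R (\<i> * cis (- 2 * t))) / 4)) (at t within {0..2*pi})"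
            unfolding cis_conv_exp
            by (auto intro!: derivative_eq_intros has_vector_derivative_real_field simp: scaleR_conv_of_real algebra_simps)
          moreover have "of_real 1 / 2 + \<i> * ((-2) *\<^sub>R (\<i> * cis (- 2 * t))) / 4 = cis (- t) * of_real (cos t)"
          proof -
            have "cis (- 2 * t) = cis (- t) * cis (- t)" by (simp add: cis_mult)
            moreover have "cis (-t) * cis t = 1" by (simp add: cis_mult)
            moreover have "of_real (cos t) = (cis t + cis (- t)) / 2"
              by (simp add: complex_eq_iff)
            ultimately have "cis (- t) * of_real (cos t) = (1 + cis (- 2 * t)) / 2"
              by (simp only: times_divide_eq_right distrib_left)
            then show ?thesis
              by (simp add: scaleR_conv_of_real add_divide_distrib)
          qed
          ultimately show "((\<lambda>t. of_real t / 2 + \<i> * cis (- 2 * t) / 4) has_vector_derivative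
             cis (- t) * of_real (cos t)) (at t within {0..2*pi})" by simp
        qed simp
        moreover have "cis (- 2 * (2*pi)) = 1"
          using cis_multiple_2pi[of "-2"] by (simp add: mult.commute)
        ultimately show ?thesis by simp
      qed
      ultimately show ?thesis
        by (simp add: integral_unique)
    qed
    show "F (c \<bullet>\<^sub>c x) = c * F x" if c: "cmod c = 1" and x: "x \<in> topspace P" for c x
    proof -
      \<comment> \<open>\<open>Arg2pi\<close> yields an angle between 0 and 2 * pi, the range of
        shifts that \<open>integral_shift_periodic\<close> accepts.\<close>
      define a where "a = Arg2pi c"
      have a: "0 \<le> a" "a \<le> 2 * pi" "c = cis a"
        using Arg2pi[of c] c complex_norm_eq_1_exp[of c] by (auto simp: a_def cis_conv_exp)
      let ?g = "\<lambda>t. cis (- t) * of_real (f (cis t \<bullet>\<^sub>c x))"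
      have "F (c \<bullet>\<^sub>c x) = integral {0..2*pi} (\<lambda>t. cis a * ?g (t + a))"
        unfolding F_def using x
        by (intro arg_cong[where f="integral _"] ext)
          (simp add: a act_act cis_mult flip: mult.assoc)
      also have "\<dots> = cis a * integral {0..2*pi} (\<lambda>t. ?g (t + a))"
        by simp
      also have "integral {0..2*pi} (\<lambda>t. ?g (t + a)) = F x"
        unfolding F_def
        by (rule integral_shift_periodic[OF contg[OF x] _ a(1,2)])
           (simp add: cis.code sin_diff cos_diff sin_add cos_add)
      finally show ?thesis by (simp add: a)
    qed
    show "continuous_map P euclidean F"
      unfolding continuous_map_atin
    proof
      fix y assume y: "y \<in> topspace P"
      have "(F \<longlongrightarrow> F y) (atin P y)"
      proof (rule tendstoI)
        fix e :: real assume e: "0 < e"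
        \<comment> \<open>Integrating the bound \<open>d\<close> over an interval of length 2 * pi
          gives e / 2, strictly below \<open>e\<close>.\<close>
        define d where "d = e / (4 * pi)"
        have d: "d > 0" using e by (simp add: d_def)
        \<comment> \<open>\<open>?H\<close> vanishes on the circle times \<open>y\<close>. The tube
          lemma gives one neighbourhood of \<open>y\<close> on which it is small for all rotations
          at once, so the integrands are uniformly close.\<close>
        let ?H = "\<lambda>(c, x). f (c \<bullet>\<^sub>c x) - f (c \<bullet>\<^sub>c y)"
        let ?X = "prod_topology ?S P"
        have H: "continuous_map ?X euclideanreal ?H"
        proof -
          have "continuous_map ?X P (\<lambda>p. fst p \<bullet>\<^sub>c y)"
            by (rule continuous_map_act) (use y continuous_map_fst[of ?S P] in
                \<open>auto simp: continuous_map_in_subtopology\<close>)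
          from continuous_map_compose[OF this f] continuous_map_compose[OF act_continuous f]
          show ?thesis
            by (simp add: o_def case_prod_unfold continuous_map_diff)
        qed
        let ?W = "{p \<in> topspace ?X. ?H p \<in> ball 0 d}"
        have "openin ?X ?W"
          by (rule openin_continuous_map_preimage[OF H]) (simp flip: open_openin)
        moreover have "compactin ?S (sphere 0 1)"
          using cS by (simp add: compact_space_def)
        moreover have "sphere 0 1 \<times> {y} \<subseteq> ?W"
          using y d by auto
        ultimately have "\<exists>A V. openin ?S A \<and> openin P V \<and> sphere 0 1 \<subseteq> A \<and> y \<in> V \<and> A \<times> V \<subseteq> ?W"
          by (intro tube_lemma_left y)
        then obtain U V where V: "openin P V" "y \<in> V" "sphere 0 1 \<subseteq> U" "U \<times> V \<subseteq> ?W"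
          by blast
        have "dist (F x) (F y) < e" if x: "x \<in> V" for x
        proof -
          have xP: "x \<in> topspace P" using V x openin_subset by blast
          let ?g = "\<lambda>z t. cis (- t) * of_real (f (cis t \<bullet>\<^sub>c z))"
          have int: "?g z integrable_on {0..2*pi}" if "z \<in> topspace P" for z
            by (rule integrable_continuous_interval[OF contg[OF that]])
          have "F x - F y = integral {0..2*pi} (\<lambda>t. ?g x t - ?g y t)"
            unfolding F_def by (rule Henstock_Kurzweil_Integration.integral_diff[symmetric, OF int[OF xP] int[OF y]])
          also have "norm \<dots> \<le> d * (2 * pi - 0)"
          proof (rule integral_bound)
            show "continuous_on {0..2*pi} (\<lambda>t. ?g x t - ?g y t)"
              by (intro continuous_on_diff contg xP y)
            fix t
            have "(cis t, x) \<in> ?W" using V(4) x subsetD[OF V(3), of "cis t"] by auto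
            then have "\<bar>f (cis t \<bullet>\<^sub>c x) - f (cis t \<bullet>\<^sub>c y)\<bar> < d" by simp
            moreover have "norm (?g x t - ?g y t) = \<bar>f (cis t \<bullet>\<^sub>c x) - f (cis t \<bullet>\<^sub>c y)\<bar>"
              by (simp add: norm_mult flip: right_diff_distrib of_real_diff)
            ultimately show "norm (?g x t - ?g y t) \<le> d" by simp
          qed simp
          also have "\<dots> < e" using e by (simp add: d_def)
          finally show ?thesis by (simp add: dist_norm)
        qed
        then show "\<forall>\<^sub>F x in atin P y. dist (F x) (F y) < e"
          using V y unfolding eventually_atin by blast
      qed
      then show "limitin euclidean F (F y) (atin P y)"
        by simp
    qed
  qed
qed

text \<open>The orbits are exactly the fibres of \<open>r\<close>, so a nonvanishing equivariant
  function singles out one point in each fibre: the one where its value is positive.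
  \<open>equivariant_function\<close> supplies such a function near \<open>s\<close>.\<close>

theorem local_section:
  fixes r :: "'p \<Rightarrow> 'x" and X :: "'x topology"
  assumes r_cont: "continuous_map P X r" and r_open: "open_map P X r" and r_surj: "r ` topspace P = topspace X"
    and X: "locally_compact_space X" "Hausdorff_space X" and P: "Hausdorff_space P"
    and invariant: "\<And>c x. \<lbrakk>cmod c = 1; x \<in> topspace P\<rbrakk> \<Longrightarrow> r (c \<bullet>\<^sub>c x) = r x"
    and transitive: "\<And>x y. \<lbrakk>x \<in> topspace P; y \<in> topspace P; r x = r y\<rbrakk> \<Longrightarrow> \<exists>c. cmod c = 1 \<and> y = c \<bullet>\<^sub>c x"
    and free: "\<And>c x. \<lbrakk>cmod c = 1; x \<in> topspace P; c \<bullet>\<^sub>c x = x\<rbrakk> \<Longrightarrow> c = 1"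
    and s: "s \<in> topspace X"
  obtains W \<sigma> where "openin X W" "s \<in> W" "continuous_map (subtopology X W) P \<sigma>"
    "\<And>y. y \<in> W \<Longrightarrow> r (\<sigma> y) = y"
proof -
  let ?S = "top_of_set (sphere (0::complex) 1)"
  have cS: "compactin ?S (sphere 0 1)"
    using compact_sphere[of "0::complex" 1] by (simp add: compactin_subtopology)
  have proper: "proper_map P X r"
    unfolding proper_map_def closed_map_fibre_neighbourhood
  proof (intro conjI allI impI ballI)
    show "r \<in> topspace P \<rightarrow> topspace X" using r_surj by blast
    fix U y
    assume U: "openin P U \<and> y \<in> topspace X \<and> {x \<in> topspace P. r x = y} \<subseteq> U"
    then obtain x where x: "x \<in> topspace P" "r x = y"
      using r_surj by (metis (no_types, lifting) imageE)
    have "c \<bullet>\<^sub>c x \<in> U" if "cmod c = 1" for c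
      using x U that by (auto simp: invariant act_closed)
    then obtain V where V: "openin P V" "x \<in> V" "\<And>c z. \<lbrakk>cmod c = 1; z \<in> V\<rbrakk> \<Longrightarrow> c \<bullet>\<^sub>c z \<in> U"
      using act_tube[of U x] U x by blast
    have "openin X (r ` V)"
      using V r_open by (simp add: open_map_def)
    moreover have "z \<in> U" if z: "z \<in> topspace P" "r z \<in> r ` V" for z
    proof -
      obtain w where w: "w \<in> V" "r z = r w" using z by blast
      then have "w \<in> topspace P" using V openin_subset by blast
      then obtain c where "cmod c = 1" "z = c \<bullet>\<^sub>c w"
        using transitive[of w z] w z by metis
      then show ?thesis using V w by auto
    qed
    ultimately show "\<exists>V. openin X V \<and> y \<in> V \<and> {x \<in> topspace P. r x \<in> V} \<subseteq> U"
      using V x by blast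
  next
    fix y assume "y \<in> topspace X"
    then obtain x where x: "x \<in> topspace P" "r x = y"
      using r_surj by (metis (no_types, lifting) imageE)
    have "continuous_map ?S P (\<lambda>c. c \<bullet>\<^sub>c x)"
      by (rule continuous_map_act) (use x in \<open>auto simp: continuous_map_from_subtopology\<close>)
    then have "compactin P ((\<lambda>c. c \<bullet>\<^sub>c x) ` sphere 0 1)"
      using image_compactin[OF cS] by blast
    also have "(\<lambda>c. c \<bullet>\<^sub>c x) ` sphere 0 1 = {z \<in> topspace P. r z = y}"
      using x transitive[of x] by (force simp: invariant act_closed)
    finally show "compactin P {z \<in> topspace P. r z = y}" .
  qed
  obtain U K where UK: "openin X U" "compactin X K" "s \<in> U" "U \<subseteq> K"
    using X s unfolding locally_compact_space_def by blast
  obtain v where v: "v \<in> topspace P" "r v = s"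
    using r_surj s by (metis (no_types, lifting) imageE)
  \<comment> \<open>\<open>P\<close> need not be compact, so the equivariant function is built over
    the compact neighbourhood \<open>K\<close> only; \<open>U\<close> is kept in order to return to
    open sets.\<close>
  define PK where "PK = {x \<in> topspace P. r x \<in> K}"
  let ?Q = "subtopology P PK"
  have PK: "compactin P PK"
    unfolding PK_def by (rule compactin_proper_map_preimage[OF proper UK(2)])
  have Q: "topspace ?Q = PK" by (auto simp: PK_def)
  interpret Q: circle_action ?Q act
  proof
    have "continuous_map (prod_topology ?S ?Q) P (\<lambda>(c, x). c \<bullet>\<^sub>c x)"
      using continuous_map_from_subtopology[OF act_continuous, of "sphere 0 1 \<times> PK"]
      by (simp add: prod_topology_subtopology(2) flip: subtopology_Times)
    then show "continuous_map (prod_topology ?S ?Q) ?Q (\<lambda>(c, x). c \<bullet>\<^sub>c x)"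
      by (auto simp: continuous_map_in_subtopology PK_def invariant act_closed)
  qed (auto simp: act_act act_one)
  obtain F where F: "continuous_map ?Q euclidean F"
    "\<And>c x. \<lbrakk>cmod c = 1; x \<in> topspace ?Q\<rbrakk> \<Longrightarrow> F (c \<bullet>\<^sub>c x) = c * F x" "F v \<noteq> 0"
  proof (rule Q.equivariant_function)
    show "compact_space ?Q" using PK by (simp add: compact_space_subtopology)
    show "Hausdorff_space ?Q" using P by (simp add: Hausdorff_space_subtopology)
    show "v \<in> topspace ?Q" using v UK by (auto simp: PK_def)
    show "c = 1" if "cmod c = 1" "c \<bullet>\<^sub>c v = v" for c using free that v by blast
  qed auto
  let ?PU = "{x \<in> topspace P. r x \<in> U}"
  define R where "R = {x \<in> topspace P. r x \<in> U \<and> F x \<noteq> 0}"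
  have PU: "openin P ?PU"
    using openin_continuous_map_preimage[OF r_cont] UK by blast
  have FU: "continuous_map (subtopology P ?PU) euclidean F"
    by (rule continuous_map_from_subtopology_mono[OF F(1)]) (use UK in \<open>auto simp: PK_def\<close>)
  have "openin (subtopology P ?PU) {x \<in> topspace (subtopology P ?PU). F x \<in> - {0}}"
    by (rule openin_continuous_map_preimage[OF FU]) (simp add: open_Compl flip: open_openin)
  moreover have "{x \<in> topspace (subtopology P ?PU). F x \<in> - {0}} = R"
    by (auto simp: R_def)
  ultimately have R: "openin P R"
    using PU openin_trans_full by auto
  define W where "W = r ` R"
  have W: "openin X W" using R r_open by (simp add: W_def open_map_def)
  \<comment> \<open>Along an orbit \<open>F\<close> is multiplied by unit scalars, so
    \<open>R\<close> is a union of orbits; an open map restricted to such a set is still open onto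
    its image.\<close>
  have R_sat: "{x \<in> topspace P. r x \<in> W} = R"
  proof -
    have "x \<in> R" if x: "x \<in> topspace P" "y \<in> R" "r x = r y" for x y
    proof -
      have y: "y \<in> topspace P" using x R_def by auto
      then obtain c where c: "cmod c = 1" "x = c \<bullet>\<^sub>c y" using transitive x by metis
      moreover have "y \<in> PK" using x UK by (auto simp: R_def PK_def)
      ultimately have "F x = c * F y" using F Q by auto
      then show ?thesis using x c by (auto simp: R_def)
    qed
    moreover have "R \<subseteq> topspace P" by (auto simp: R_def)
    ultimately show ?thesis unfolding W_def by blast
  qed
  let ?PR = "subtopology P R" and ?XW = "subtopology X W"
  have topR: "topspace ?PR = R" and topW: "topspace ?XW = W"
    using R W openin_subset by (auto simp: subset_iff)
  have rq: "quotient_map ?PR ?XW r"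
  proof (rule continuous_open_imp_quotient_map)
    show "continuous_map ?PR ?XW r"
      by (rule continuous_map_into_subtopology[OF continuous_map_from_subtopology[OF r_cont]])
        (simp add: W_def Pi_iff)
    show "open_map ?PR ?XW r" by (rule open_map_restriction[OF r_open R_sat])
    show "r ` topspace ?PR = topspace ?XW" by (simp only: topR topW) (simp add: W_def)
  qed
  text \<open>The phase below makes \<open>f x\<close> independent of the choice of \<open>x\<close> in its orbit.\<close>
  define f where "f x = (cnj (F x) / of_real (cmod (F x))) \<bullet>\<^sub>c x" for x
  define \<sigma> where "\<sigma> y = f (SOME x. x \<in> R \<and> r x = y)" for y
  have phase: "cmod (cnj (F x) / of_real (cmod (F x))) = 1" if "x \<in> R" for x
    using that by (simp add: R_def norm_divide)
  have R_PK: "x \<in> PK" "x \<in> topspace P" if "x \<in> R" for x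
    using that UK by (auto simp: R_def PK_def)
  have f_orbit: "f y = f x" if xy: "x \<in> R" "y \<in> R" "r x = r y" for x y
  proof -
    obtain c where c: "cmod c = 1" "y = c \<bullet>\<^sub>c x"
      using transitive xy R_PK by metis
    have Fy: "F y = c * F x" using F R_PK xy c Q by auto
    have "cnj c * c = 1"
      using c complex_norm_square[of c] by (simp add: mult.commute)
    then have "cnj (F y) / of_real (cmod (F y)) * c = cnj (F x) / of_real (cmod (F x))"
      by (simp add: Fy norm_mult c(1))
    then show ?thesis
      using act_act[OF phase[OF xy(2)] c(1) R_PK(2)[OF xy(1)]] by (simp add: f_def flip: c(2))
  qed
  have \<sigma>r: "\<sigma> (r x) = f x" if "x \<in> R" for x
    unfolding \<sigma>_def
  proof (rule someI2)
    show "x \<in> R \<and> r x = r x" using that by simp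
    show "f z = f x" if "z \<in> R \<and> r z = r x" for z
      by (rule f_orbit) (use that \<open>x \<in> R\<close> in simp_all)
  qed
  have "continuous_map ?PR P f"
    unfolding f_def
  proof (rule continuous_map_act)
    have FR: "continuous_map ?PR euclidean F"
      by (rule continuous_map_from_subtopology_mono[OF F(1)]) (use R_PK in auto)
    then show "continuous_map ?PR euclidean (\<lambda>x. cnj (F x) / of_real (cmod (F x)))"
      by (auto simp: continuous_map_atin R_def intro!: tendsto_intros)
    show "continuous_map ?PR P (\<lambda>x. x)"
      by (simp add: continuous_map_from_subtopology)
  qed (use phase in simp)
  \<comment> \<open>\<open>\<sigma>\<close> is defined through \<open>SOME\<close>, so its
    continuity is tested after composing with the quotient map \<open>r\<close>, where it becomes
    the continuous \<open>f\<close>.\<close>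
  then have "continuous_map ?PR P (\<sigma> \<circ> r)"
    by (rule continuous_map_eq) (simp add: \<sigma>r)
  then have "continuous_map ?XW P \<sigma>"
    by (rule continuous_compose_quotient_map[OF rq])
  moreover have "r (\<sigma> y) = y" if "y \<in> W" for y
    using that phase R_PK by (auto simp: W_def \<sigma>r f_def invariant)
  moreover have "s \<in> W"
    using v UK F by (auto simp: W_def R_def)
  ultimately show ?thesis using that W by blast
qed

end


section \<open>Matrix algebras\<close>

text \<open>A name for what \<open>matrix_alg\<close> spells out as a lambda term, as is
  \<open>mat_adj\<close> below, so that simplification rules can refer to it.\<close>

definition mat_smult :: "complex \<Rightarrow> complex^'n^'n \<Rightarrow> complex^'n^'n" where
  "mat_smult c M = (\<chi> i j. c * M $ i $ j)"

definition mat_adj :: "complex^'n^'n \<Rightarrow> complex^'n^'n" where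
  "mat_adj M = (\<chi> i j. cnj (M $ j $ i))"

definition mat_unit :: "'n \<Rightarrow> 'n \<Rightarrow> complex^'n^'n" where
  "mat_unit i j = (\<chi> k l. if k = i \<and> l = j then 1 else 0)"

lemma mat_smult_nth [simp]: "mat_smult c M $ i $ j = c * M $ i $ j"
  by (simp add: mat_smult_def)

lemma mat_adj_nth [simp]: "mat_adj M $ i $ j = cnj (M $ j $ i)"
  by (simp add: mat_adj_def)

lemma mat_unit_nth: "mat_unit i j $ k $ l = (if k = i \<and> l = j then 1 else 0)"
  by (simp add: mat_unit_def)

lemma mat_unit_nth_same [simp]: "mat_unit i j $ i $ j = 1"
  by (simp add: mat_unit_def)

lemma mat_eqI: "(\<And>i j. M $ i $ j = N $ i $ j) \<Longrightarrow> M = (N :: complex^'n^'n)"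
  by (simp add: vec_eq_iff)

lemma mat_mul_nth: "(M ** N) $ i $ j = (\<Sum>k\<in>UNIV. M $ i $ k * N $ k $ j)"
  by (simp add: matrix_matrix_mult_def)

lemma mul_mat_unit_nth: "(M ** mat_unit i j) $ k $ l = (if l = j then M $ k $ i else 0)"
  by (simp add: mat_mul_nth mat_unit_nth if_distrib cong: if_cong)

lemma mat_unit_mul_nth: "(mat_unit i j ** M) $ k $ l = (if k = i then M $ j $ l else 0)"
  by (simp add: mat_mul_nth mat_unit_nth if_distrib[of "\<lambda>x. x * _"] cong: if_cong)

lemma mat_unit_mul_mat_unit: "mat_unit i j ** mat_unit k l = (if j = k then mat_unit i l else 0)"
  by (rule mat_eqI) (simp add: mul_mat_unit_nth mat_unit_nth)

text \<open>Compression to a corner isolates one entry. The bound of an entry by the norm and the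
  complex line in \<open>normalized_section\<close> both rest on this.\<close>

lemma mat_unit_corner: "mat_unit i i ** M ** mat_unit j j = mat_smult (M $ i $ j) (mat_unit i j)"
  by (rule mat_eqI) (simp add: mul_mat_unit_nth mat_unit_mul_nth mat_unit_nth)

lemma mat_adj_unit [simp]: "mat_adj (mat_unit i j) = mat_unit j i"
  by (rule mat_eqI) (simp add: mat_unit_nth)

lemma mat_unit_nonzero [simp]: "mat_unit i j \<noteq> 0"
  by (metis mat_unit_nth_same zero_index zero_neq_one)

lemma diagonalI: "(\<And>i j. i \<noteq> j \<Longrightarrow> M $ i $ j = 0) \<Longrightarrow> M \<in> diagonal"
  by (simp add: diagonal_def)

lemma diagonalD: "\<lbrakk>M \<in> diagonal; i \<noteq> j\<rbrakk> \<Longrightarrow> M $ i $ j = 0"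
  by (simp add: diagonal_def)

lemma mat_unit_diagonal [simp]: "mat_unit i i \<in> diagonal"
  by (rule diagonalI) (auto simp: mat_unit_nth)

lemma diagonal_mul_nth:
  assumes "M \<in> diagonal"
  shows "(M ** N) $ i $ j = M $ i $ i * N $ i $ j"
proof -
  have "(M ** N) $ i $ j = (\<Sum>k\<in>UNIV. if k = i then M $ i $ i * N $ i $ j else 0)"
    unfolding mat_mul_nth by (rule sum.cong) (auto simp: diagonalD[OF assms])
  then show ?thesis by simp
qed

lemma mat_adj_mul: "mat_adj (M ** N) = mat_adj N ** mat_adj M"
  by (rule mat_eqI) (simp add: mat_mul_nth mult.commute)

lemma mat_smult_mul: "mat_smult c M ** N = mat_smult c (M ** N)"
  by (rule mat_eqI) (simp add: mat_mul_nth sum_distrib_left mult.assoc)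

lemma mul_mat_smult: "M ** mat_smult c N = mat_smult c (M ** N)"
  by (rule mat_eqI) (simp add: mat_mul_nth sum_distrib_left mult.left_commute)

lemma add_mat_mul: "(M + N :: complex^'n^'n) ** L = M ** L + N ** (L :: complex^'n^'n)"
  by (rule mat_eqI) (simp add: mat_mul_nth sum.distrib distrib_right)

lemma mat_mul_add: "(L :: complex^'n^'n) ** (M + N) = L ** M + L ** (N :: complex^'n^'n)"
  by (rule mat_eqI) (simp add: mat_mul_nth sum.distrib distrib_left)

lemma star_iso_matrix_alg_iff:
  "star_iso A matrix_alg h \<longleftrightarrow> bij_betw h (carr A) UNIV \<and>
     (\<forall>x\<in>carr A. \<forall>y\<in>carr A. h (x \<oplus>\<^bsub>A\<^esub> y) = h x + h y) \<and>
     (\<forall>c. \<forall>x\<in>carr A. h (c \<odot>\<^bsub>A\<^esub> x) = mat_smult c (h x)) \<and>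
     (\<forall>x\<in>carr A. \<forall>y\<in>carr A. h (x \<otimes>\<^bsub>A\<^esub> y) = h x ** h y) \<and>
     (\<forall>x\<in>carr A. h (adj\<^bsub>A\<^esub> x) = mat_adj (h x))"
  by (simp add: star_iso_def matrix_alg_def mat_smult_def mat_adj_def)

section \<open>Changes of frame: unitaries, phases, permutations\<close>

lemma star_iso_matrix_alg_compose:
  assumes "star_iso A matrix_alg h" "bij f"
    "\<And>M N. f (M + N) = f M + f N" "\<And>c M. f (mat_smult c M) = mat_smult c (f M)"
    "\<And>M N. f (M ** N) = f M ** f N" "\<And>M. f (mat_adj M) = mat_adj (f M)"
  shows "star_iso A matrix_alg (f \<circ> h)"
  using assms unfolding star_iso_matrix_alg_iff
  by (auto intro: bij_betw_trans)

lemma star_iso_unitary_conj: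
  fixes U :: "complex^'n^'n"
  assumes h: "star_iso A matrix_alg h" and U: "U ** mat_adj U = mat 1" "mat_adj U ** U = mat 1"
  shows "star_iso A matrix_alg (\<lambda>x. mat_adj U ** h x ** U)"
proof -
  let ?f = "\<lambda>M. mat_adj U ** M ** U"
  have 1: "U ** (mat_adj U ** M) = M" "mat_adj U ** (U ** M) = M" for M :: "complex^'n^'n"
    using U by (simp_all add: matrix_mul_assoc)
  have "bij ?f"
    by (rule o_bij[where g="\<lambda>M. U ** M ** mat_adj U"])
       (simp_all add: fun_eq_iff 1 U flip: matrix_mul_assoc)
  moreover have "mat_adj (mat_adj U) = U" by (rule mat_eqI) simp
  ultimately have "star_iso A matrix_alg (?f \<circ> h)"
    by (intro star_iso_matrix_alg_compose[OF h])
      (simp_all add: 1 add_mat_mul mat_mul_add mat_smult_mul mul_mat_smult mat_adj_mul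
        flip: matrix_mul_assoc)
  then show ?thesis by (simp add: o_def)
qed

text \<open>Conjugation by the diagonal unitary with entries \<open>l\<close>. Such a conjugation
  absorbs phases and keeps diagonal matrices diagonal.\<close>

lemma star_iso_phase:
  fixes l :: "'n::finite \<Rightarrow> complex"
  assumes h: "star_iso A matrix_alg h" and l: "\<And>i. cmod (l i) = 1"
  shows "star_iso A matrix_alg (\<lambda>x. \<chi> i j. cnj (l i) * h x $ i $ j * l j)"
proof -
  let ?U = "(\<chi> i j. if i = j then l j else 0) :: complex^'n^'n"
  have U: "?U \<in> diagonal" "mat_adj ?U \<in> diagonal" by (auto intro!: diagonalI)
  have "cnj (l i) * l i = 1" for i
    using l[of i] complex_norm_square[of "l i"] by (simp add: mult.commute)
  then have "?U ** mat_adj ?U = mat 1" "mat_adj ?U ** ?U = mat 1"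
    by (auto intro!: mat_eqI simp: diagonal_mul_nth[OF U(1)] diagonal_mul_nth[OF U(2)] mat_def mult.commute)
  moreover have "(M ** ?U) $ i $ j = M $ i $ j * l j" for M :: "complex^'n^'n" and i j
    by (simp add: mat_mul_nth if_distrib cong: if_cong)
  then have "mat_adj ?U ** M ** ?U = (\<chi> i j. cnj (l i) * M $ i $ j * l j)" for M
    by (intro mat_eqI) (simp add: diagonal_mul_nth[OF U(2)])
  ultimately show ?thesis
    using star_iso_unitary_conj[OF h, of ?U] by simp
qed

text \<open>Conjugation by a permutation matrix, written entrywise so that multiplicativity is a
  reindexing of the sum.\<close>

lemma star_iso_permute:
  fixes p :: "'n::finite \<Rightarrow> 'n"
  assumes h: "star_iso A matrix_alg h" and p: "bij p"
  shows "star_iso A matrix_alg (\<lambda>x. \<chi> i j. h x $ p i $ p j)"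
proof -
  let ?f = "\<lambda>M :: complex^'n^'n. (\<chi> i j. M $ p i $ p j) :: complex^'n^'n"
  have "bij ?f"
    by (rule o_bij[where g="\<lambda>M. \<chi> i j. M $ inv p i $ inv p j"])
       (use p in \<open>simp_all add: fun_eq_iff vec_eq_iff bij_inv_eq_iff bij_is_inj surj_f_inv_f bij_is_surj\<close>)
  moreover have "?f (M ** N) = ?f M ** ?f N" for M N
    by (rule mat_eqI) (simp add: mat_mul_nth sum.reindex_bij_betw[OF p, of "\<lambda>k. M $ _ $ k * N $ k $ _"])
  ultimately have "star_iso A matrix_alg (?f \<circ> h)"
    by (intro star_iso_matrix_alg_compose[OF h]) (simp_all add: vec_eq_iff)
  then show ?thesis by (simp add: o_def)
qed

text \<open>A nonzero projection has a nonzero column, which lies in its range, and columns of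
  different projections are orthogonal. One normalized column from each projection becomes a column
  of the unitary.\<close>

lemma orthogonal_projections_unitary:
  fixes E :: "'n::finite \<Rightarrow> complex^'n^'n"
  assumes orth: "\<And>i j. E i ** E j = (if i = j then E i else 0)"
    and adj: "\<And>i. mat_adj (E i) = E i" and nz: "\<And>i. E i \<noteq> 0"
  obtains U where "U ** mat_adj U = mat 1" "mat_adj U ** U = mat 1"
    "\<And>i. mat_adj U ** E i ** U = mat_unit i i"
proof -
  have diag: "E i $ a $ a = of_real (\<Sum>k\<in>UNIV. (cmod (E i $ k $ a))\<^sup>2)" for i a
  proof -
    have "E i $ a $ a = (mat_adj (E i) ** E i) $ a $ a"
      by (simp add: adj orth)
    also have "\<dots> = (\<Sum>k\<in>UNIV. cnj (E i $ k $ a) * E i $ k $ a)"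
      by (simp add: mat_mul_nth)
    finally show ?thesis
      by (simp add: complex_norm_square mult.commute del: of_real_power)
  qed
  have "\<exists>a. E i $ a $ a \<noteq> 0" for i
  proof -
    obtain k a where ka: "E i $ k $ a \<noteq> 0"
      using nz[of i] by (auto simp: vec_eq_iff)
    have "0 < (cmod (E i $ k $ a))\<^sup>2" using ka by simp
    also have "\<dots> \<le> (\<Sum>k\<in>UNIV. (cmod (E i $ k $ a))\<^sup>2)"
      by (rule member_le_sum) auto
    finally show ?thesis
      using diag[of i a] by (metis of_real_eq_0_iff less_irrefl)
  qed
  then obtain a where a: "\<And>i. E i $ a i $ a i \<noteq> 0" by metis
  \<comment> \<open>By \<open>diag\<close>, the squared length of column \<open>a i\<close> is the
    diagonal entry there, so dividing by \<open>c i\<close> makes it a unit vector.\<close>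
  define c where "c i = sqrt (Re (E i $ a i $ a i))" for i
  have "of_real (Re (E i $ a i $ a i)) = E i $ a i $ a i" "Re (E i $ a i $ a i) \<ge> 0" for i
    by (simp_all add: diag sum_nonneg)
  then have c: "of_real (c i) * of_real (c i) = E i $ a i $ a i" "c i \<noteq> 0" for i
    using a[of i] by (simp_all add: c_def flip: of_real_mult) (metis of_real_0)
  define U :: "complex^'n^'n" where "U = (\<chi> k i. E i $ k $ a i / of_real (c i))"
  have E_U: "(E i ** U) $ k $ l = (if i = l then U $ k $ l else 0)" for i k l
  proof -
    have "(E i ** U) $ k $ l = (E i ** E l) $ k $ a l / of_real (c l)"
      by (simp add: mat_mul_nth U_def sum_divide_distrib)
    then show ?thesis by (simp add: orth U_def)
  qed
  have U_U: "(\<Sum>k\<in>UNIV. cnj (U $ k $ j) * U $ k $ l) = (if j = l then 1 else 0)" for j l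
  proof -
    have "(\<Sum>k\<in>UNIV. cnj (U $ k $ j) * U $ k $ l) = (mat_adj (E j) ** E l) $ a j $ a l / (of_real (c j) * of_real (c l))"
      by (simp add: mat_mul_nth U_def sum_divide_distrib)
    then show ?thesis using c[of l] a[of l] by (simp add: adj orth)
  qed
  have "mat_adj U ** U = mat 1"
    by (rule mat_eqI) (simp add: mat_mul_nth U_U mat_def)
  \<comment> \<open>Projections and coordinates have the same index type, so \<open>U\<close> is
    square and orthonormal columns already make it unitary.\<close>
  moreover from this have "U ** mat_adj U = mat 1"
    using matrix_left_right_inverse by blast
  moreover have "mat_adj U ** E i ** U = mat_unit i i" for i
  proof -
    have "(mat_adj U ** (E i ** U)) $ j $ l = mat_unit i i $ j $ l" for j l
      using U_U[of j l] by (cases "i = l") (auto simp: mat_mul_nth[of "mat_adj U"] E_U mat_unit_nth)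
    then show ?thesis by (simp add: mat_eqI flip: matrix_mul_assoc)
  qed
  ultimately show ?thesis using that by blast
qed

section \<open>C*-norms on matrix fibres compared with matrix entries\<close>

locale matrix_cstar_algebra = cstar_algebra A
  for A :: "'a star_alg" (structure) +
  fixes h :: "'a \<Rightarrow> complex^'n^'n"
  assumes iso: "star_iso A matrix_alg h"
begin

lemma h_bij: "bij_betw h (carr A) UNIV"
  and h_add: "\<lbrakk>x \<in> carr A; y \<in> carr A\<rbrakk> \<Longrightarrow> h (x \<oplus> y) = h x + h y"
  and h_smul: "x \<in> carr A \<Longrightarrow> h (c \<odot> x) = mat_smult c (h x)"
  and h_mul: "\<lbrakk>x \<in> carr A; y \<in> carr A\<rbrakk> \<Longrightarrow> h (x \<otimes> y) = h x ** h y"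
  and h_adj: "x \<in> carr A \<Longrightarrow> h (adj x) = mat_adj (h x)"
  using iso by (auto simp: star_iso_matrix_alg_iff)

lemma h_inject: "\<lbrakk>x \<in> carr A; y \<in> carr A\<rbrakk> \<Longrightarrow> h x = h y \<longleftrightarrow> x = y"
  using h_bij by (auto simp: bij_betw_def inj_on_def)

lemma sub_closed: "\<lbrakk>x \<in> carr A; y \<in> carr A\<rbrakk> \<Longrightarrow> x \<ominus> y \<in> carr A"
  by (simp add: sub_def add_closed smul_closed)

lemma h_sub: "\<lbrakk>x \<in> carr A; y \<in> carr A\<rbrakk> \<Longrightarrow> h (x \<ominus> y) = h x - h y"
  by (simp add: sub_def h_add h_smul smul_closed vec_eq_iff)

lemma h_zero: "h \<zero> = 0"
  using h_sub[OF zero_closed zero_closed] sub_self[OF zero_closed] by simp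

definition k :: "complex^'n^'n \<Rightarrow> 'a" where "k = inv_into (carr A) h"

lemma k_closed [simp]: "k M \<in> carr A"
  using h_bij by (simp add: k_def bij_betw_def inv_into_into)

lemma h_k [simp]: "h (k M) = M"
  using h_bij by (simp add: k_def bij_betw_def f_inv_into_f)

lemma k_h [simp]: "x \<in> carr A \<Longrightarrow> k (h x) = x"
  using h_bij by (simp add: k_def bij_betw_def)

lemma k_eqI: "\<lbrakk>x \<in> carr A; h x = M\<rbrakk> \<Longrightarrow> k M = x"
  by auto

lemma nrm_projection:
  assumes "x \<in> carr A" "h x \<noteq> 0" "mat_adj (h x) ** h x = h x"
  shows "nrm x = 1"
proof -
  have "adj x \<otimes> x = x"
    using assms by (simp add: h_adj h_mul adj_closed mul_closed flip: h_inject)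
  then have "(nrm x)\<^sup>2 = nrm x"
    using cstar_identity[OF assms(1)] by simp
  moreover have "nrm x \<noteq> 0"
    using assms h_zero nrm_eq_zero by auto
  ultimately show ?thesis by (simp add: power2_eq_square)
qed

text \<open>\<open>h\<close> is only assumed algebraic, yet the C*-identity fixes these norms: the
  adjoint of a unit times the unit is a nonzero projection, and the norm of a projection equals its
  own square.\<close>

lemma nrm_mat_unit: "nrm (k (mat_unit i j)) = 1"
proof -
  have "adj (k (mat_unit i j)) \<otimes> k (mat_unit i j) = k (mat_unit j j)"
    by (simp add: h_adj h_mul adj_closed mul_closed mat_unit_mul_mat_unit flip: h_inject)
  moreover have "nrm (k (mat_unit j j)) = 1"
    by (rule nrm_projection) (auto simp: mat_unit_mul_mat_unit)
  ultimately have "(nrm (k (mat_unit i j)))\<^sup>2 = 1"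
    using cstar_identity[OF k_closed] by metis
  then show ?thesis
    using nrm_nonneg[OF k_closed, of "mat_unit i j"] by (simp add: power2_eq_1_iff)
qed

lemma nrm_scaled_unit: "nrm (k (mat_smult c (mat_unit i j))) = cmod c"
proof -
  have "k (mat_smult c (mat_unit i j)) = c \<odot> k (mat_unit i j)"
    by (rule k_eqI) (auto simp: h_smul smul_closed)
  then show ?thesis by (simp add: nrm_smul nrm_mat_unit)
qed

text \<open>The entry is the norm of a compression of \<open>x\<close> by two factors of norm 1, so
  submultiplicativity is enough.\<close>

lemma entry_le_nrm:
  assumes "x \<in> carr A"
  shows "cmod (h x $ i $ j) \<le> nrm x"
proof -
  let ?e = "\<lambda>i. k (mat_unit i i)"
  have eq: "k (mat_smult (h x $ i $ j) (mat_unit i j)) = ?e i \<otimes> x \<otimes> ?e j"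
    by (rule k_eqI) (auto simp: assms mul_closed h_mul mat_unit_corner)
  have "nrm (?e i \<otimes> x \<otimes> ?e j) \<le> nrm (?e i \<otimes> x) * nrm (?e j)"
    by (intro nrm_mul mul_closed assms k_closed)
  also have "\<dots> \<le> nrm x"
    using nrm_mul[OF k_closed assms, of "mat_unit i i"] by (simp add: nrm_mat_unit)
  finally show ?thesis by (simp add: nrm_scaled_unit flip: eq)
qed

text \<open>The sharp bound is the maximum. The sum comes from the triangle inequality, one entry at
  a time, and the factor it loses is absorbed by the constant in
  \<open>idempotent_rounding\<close>.\<close>

lemma nrm_diagonal_le:
  assumes x: "x \<in> carr A" "h x \<in> diagonal"
  shows "nrm x \<le> (\<Sum>i\<in>UNIV. cmod (h x $ i $ i))"
proof -
  let ?D = "\<lambda>F. \<chi> i j. if i = j \<and> i \<in> F then h x $ i $ i else 0"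
  have bound: "nrm (k (?D F)) \<le> (\<Sum>i\<in>F. cmod (h x $ i $ i))" if "finite F" for F
    using that
  proof (induction F)
    case empty
    have "k (?D {}) = \<zero>"
      by (rule k_eqI) (simp_all add: zero_closed h_zero vec_eq_iff)
    then show ?case using nrm_eq_zero[OF zero_closed] by simp
  next
    case (insert a F)
    let ?y = "k (mat_smult (h x $ a $ a) (mat_unit a a))"
    have "k (?D (insert a F)) = ?y \<oplus> k (?D F)"
      using insert(2) by (intro k_eqI) (auto simp: add_closed h_add vec_eq_iff mat_unit_nth)
    then have "nrm (k (?D (insert a F))) \<le> nrm ?y + nrm (k (?D F))"
      by (simp add: nrm_add)
    then show ?case using insert by (simp add: nrm_scaled_unit)
  qed
  have "k (?D UNIV) = x"
    by (rule k_eqI) (auto simp: x vec_eq_iff diagonalD[OF x(2)])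
  then show ?thesis using bound[of UNIV] by simp
qed

end


section \<open>Bundle operations\<close>

lemma fibre_simps [simp]:
  "carr (fibre E t) = {x \<in> topspace (total E). proj E x = t}"
  "add (fibre E t) = badd E" "zero (fibre E t) = bzero E t" "smul (fibre E t) = bsmul E"
  "mul (fibre E t) = bmul E" "involution (fibre E t) = badj E" "cnorm (fibre E t) = bnrm E"
  by (simp_all add: fibre_def)

text \<open>Defined once on the total space, so that it can be treated as one continuous map;
  \<open>sub_fibre\<close> identifies it with the difference in each fibre.\<close>

definition bsub :: "('t, 'e) star_bundle \<Rightarrow> 'e \<Rightarrow> 'e \<Rightarrow> 'e" where
  "bsub E x y = badd E x (bsmul E (- 1) y)"

lemma sub_fibre [simp]: "sub (fibre E t) = bsub E"
  by (simp add: sub_def bsub_def fun_eq_iff)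

lemma (in cstar_algebra) sub_eq_zeroD:
  assumes "x \<in> carr A" "y \<in> carr A" "x \<ominus> y = \<zero>"
  shows "x = y"
proof -
  have my: "(- 1) \<odot> y \<in> carr A" by (simp add: assms smul_closed)
  have "x = x \<oplus> (y \<ominus> y)" by (simp add: assms sub_self add_zero)
  also have "\<dots> = x \<oplus> ((- 1) \<odot> y \<oplus> y)"
    by (simp add: sub_def add_commute[OF assms(2) my])
  also have "\<dots> = (x \<ominus> y) \<oplus> y"
    by (simp add: sub_def assms my add_assoc)
  also have "\<dots> = y"
    by (simp add: assms zero_closed add_commute[OF zero_closed] add_zero)
  finally show ?thesis .
qed

context cstar_bundle
begin

lemma proj_in_base: "x \<in> topspace (total E) \<Longrightarrow> proj E x \<in> topspace (base E)"
  using proj_surj by blast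

lemma fibre_of: "x \<in> topspace (total E) \<Longrightarrow> cstar_algebra (fibre E (proj E x))"
  by (simp add: fibre_cstar proj_in_base)

lemma
  assumes "x \<in> topspace (total E)"
  shows bsmul_total: "bsmul E c x \<in> topspace (total E)" and proj_bsmul: "proj E (bsmul E c x) = proj E x"
    and badj_total: "badj E x \<in> topspace (total E)" and proj_badj: "proj E (badj E x) = proj E x"
  using cstar_algebra.smul_closed[OF fibre_of[OF assms], of x c]
    cstar_algebra.adj_closed[OF fibre_of[OF assms], of x] assms by auto

lemma
  assumes "x \<in> topspace (total E)" "y \<in> topspace (total E)" "proj E x = proj E y"
  shows proj_badd: "proj E (badd E x y) = proj E y"
    and bmul_total: "bmul E x y \<in> topspace (total E)" and proj_bmul: "proj E (bmul E x y) = proj E y"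
    and bsub_total: "bsub E x y \<in> topspace (total E)" and proj_bsub: "proj E (bsub E x y) = proj E y"
proof -
  interpret F: cstar_algebra "fibre E (proj E y)" by (rule fibre_of[OF assms(2)])
  show "proj E (badd E x y) = proj E y"
    "bmul E x y \<in> topspace (total E)" "proj E (bmul E x y) = proj E y"
    "bsub E x y \<in> topspace (total E)" "proj E (bsub E x y) = proj E y"
    using F.add_closed[of x y] F.mul_closed[of x y] F.add_closed[of x "bsmul E (- 1) y"] F.smul_closed[of y "-1"]
      assms by (auto simp: bsub_def)
qed

lemma
  assumes f: "continuous_map X (total E) f" and g: "continuous_map X (total E) g"
    and fg: "\<And>x. x \<in> topspace X \<Longrightarrow> proj E (f x) = proj E (g x)"
  shows continuous_map_badd: "continuous_map X (total E) (\<lambda>x. badd E (f x) (g x))"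
    and continuous_map_bmul: "continuous_map X (total E) (\<lambda>x. bmul E (f x) (g x))"
proof -
  have fp: "continuous_map X (fibre_product E) (\<lambda>x. (f x, g x))"
    unfolding fibre_product_def using assms
    by (intro continuous_map_into_subtopology) (auto simp: continuous_map_paired)
  show "continuous_map X (total E) (\<lambda>x. badd E (f x) (g x))"
    using continuous_map_compose[OF fp add_continuous] by (simp add: o_def)
  show "continuous_map X (total E) (\<lambda>x. bmul E (f x) (g x))"
    using continuous_map_compose[OF fp mul_continuous] by (simp add: o_def)
qed

lemma continuous_map_bsmul:
  assumes c: "continuous_map X euclidean c" and f: "continuous_map X (total E) f"
  shows "continuous_map X (total E) (\<lambda>x. bsmul E (c x) (f x))"
proof -
  have "continuous_map X (prod_topology euclidean (total E)) (\<lambda>x. (c x, f x))"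
    using assms by (simp add: continuous_map_paired)
  from continuous_map_compose[OF this smul_continuous] show ?thesis
    by (simp add: o_def)
qed

lemma continuous_map_badj:
  "continuous_map X (total E) f \<Longrightarrow> continuous_map X (total E) (\<lambda>x. badj E (f x))"
  using continuous_map_compose[OF _ adj_continuous] by (simp add: o_def)

lemma continuous_map_bnrm:
  "continuous_map X (total E) f \<Longrightarrow> continuous_map X euclideanreal (\<lambda>x. bnrm E (f x))"
  using continuous_map_compose[OF _ nrm_continuous] by (simp add: o_def)

lemma continuous_map_bsub:
  assumes f: "continuous_map X (total E) f" and g: "continuous_map X (total E) g"
    and fg: "\<And>x. x \<in> topspace X \<Longrightarrow> proj E (f x) = proj E (g x)"
  shows "continuous_map X (total E) (\<lambda>x. bsub E (f x) (g x))"
  unfolding bsub_def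
proof (intro continuous_map_badd continuous_map_bsmul f g)
  fix x assume x: "x \<in> topspace X"
  then have "g x \<in> topspace (total E)" using continuous_map_funspace[OF g] by auto
  then show "proj E (f x) = proj E (bsmul E (- 1) (g x))"
    by (simp add: proj_bsmul fg x)
qed auto

lemma topspace_fibre_product:
  "topspace (fibre_product E) = {(x, y). x \<in> topspace (total E) \<and> y \<in> topspace (total E) \<and> proj E x = proj E y}"
  by (auto simp: fibre_product_def)

text \<open>Bundle operations are continuous only on pairs over a common point. An open set of such
  pairs is the trace of an open set of the full product, which contains a box around the given
  pair.\<close>

lemma fibre_product_neighbourhood:
  assumes f: "continuous_map (fibre_product E) Y f" and V: "openin Y V"
    and xy: "x \<in> topspace (total E)" "y \<in> topspace (total E)" "proj E x = proj E y" "f (x, y) \<in> V"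
  obtains G H where "openin (total E) G" "openin (total E) H" "x \<in> G" "y \<in> H"
    "\<And>a b. \<lbrakk>a \<in> G; b \<in> H; proj E a = proj E b\<rbrakk> \<Longrightarrow> f (a, b) \<in> V"
proof -
  have "openin (fibre_product E) {p \<in> topspace (fibre_product E). f p \<in> V}"
    by (rule openin_continuous_map_preimage[OF f V])
  then obtain O' where O': "openin (prod_topology (total E) (total E)) O'"
    "{p \<in> topspace (fibre_product E). f p \<in> V} = O' \<inter> {(x, y). proj E x = proj E y}"
    unfolding fibre_product_def openin_subtopology by metis
  have "(x, y) \<in> O' \<inter> {(x, y). proj E x = proj E y}"
    unfolding O'(2)[symmetric] using xy by (simp add: topspace_fibre_product)
  then have "(x, y) \<in> O'" by simp
  from O'(1)[unfolded openin_prod_topology_alt, rule_format, OF this]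
  obtain G H where GH: "openin (total E) G" "openin (total E) H" "x \<in> G" "y \<in> H" "G \<times> H \<subseteq> O'"
    by blast
  have "f (a, b) \<in> V" if "a \<in> G" "b \<in> H" "proj E a = proj E b" for a b
  proof -
    have "(a, b) \<in> O' \<inter> {(x, y). proj E x = proj E y}" using that GH by auto
    then show ?thesis unfolding O'(2)[symmetric] by simp
  qed
  then show ?thesis using that GH by blast
qed

lemma continuous_map_fibre_distance:
  "continuous_map (fibre_product E) euclideanreal (\<lambda>(x, y). bnrm E (bsub E x y))"
proof -
  have "continuous_map (fibre_product E) (total E) fst" "continuous_map (fibre_product E) (total E) snd"
    unfolding fibre_product_def
    by (simp_all add: continuous_map_from_subtopology continuous_map_fst continuous_map_snd)
  then have "continuous_map (fibre_product E) euclideanreal (\<lambda>p. bnrm E (bsub E (fst p) (snd p)))"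
    by (intro continuous_map_bnrm continuous_map_bsub) (auto simp: topspace_fibre_product)
  then show ?thesis by (simp add: case_prod_unfold)
qed

lemma bsub_self: "x \<in> topspace (total E) \<Longrightarrow> bsub E x x = bzero E (proj E x)"
  using cstar_algebra.sub_self[OF fibre_of, of x x] by simp

lemma bnrm_zero: "t \<in> topspace (base E) \<Longrightarrow> bnrm E (bzero E t) = 0"
  using cstar_algebra.nrm_eq_zero[OF fibre_cstar, of t "bzero E t"]
    cstar_algebra.zero_closed[OF fibre_cstar, of t] by simp

lemma bnrm_bsub_self: "x \<in> topspace (total E) \<Longrightarrow> bnrm E (bsub E x x) = 0"
  by (simp add: bsub_self bnrm_zero proj_in_base)

text \<open>Within a fibre, the fibrewise distance stays nonzero near a pair of distinct points,
  while a common point of the two neighbourhoods would have distance 0 from itself. Points of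
  different fibres are separated in the base.\<close>

lemma Hausdorff_total:
  assumes "Hausdorff_space (base E)"
  shows "Hausdorff_space (total E)"
  unfolding Hausdorff_space_def
proof (intro allI impI, elim conjE)
  fix x y assume xy: "x \<in> topspace (total E)" "y \<in> topspace (total E)" "x \<noteq> y"
  show "\<exists>U V. openin (total E) U \<and> openin (total E) V \<and> x \<in> U \<and> y \<in> V \<and> disjnt U V"
  proof (cases "proj E x = proj E y")
    case True
    interpret F: cstar_algebra "fibre E (proj E y)" by (rule fibre_of[OF xy(2)])
    have "bnrm E (bsub E x y) \<noteq> 0"
      using F.nrm_eq_zero[of "bsub E x y"] F.sub_eq_zeroD[of x y] xy True
      by (auto simp: bsub_total proj_bsub)
    moreover have "openin euclideanreal (- {0})" by (simp add: open_Compl flip: open_openin)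
    ultimately obtain G H where GH: "openin (total E) G" "openin (total E) H" "x \<in> G" "y \<in> H"
      "\<And>a b. \<lbrakk>a \<in> G; b \<in> H; proj E a = proj E b\<rbrakk> \<Longrightarrow> (\<lambda>(x, y). bnrm E (bsub E x y)) (a, b) \<in> - {0}"
      using fibre_product_neighbourhood[OF continuous_map_fibre_distance, of "- {0}" x y] xy True
      by auto
    have "a \<notin> H" if a: "a \<in> G" for a
      using GH(5)[OF a, of a] bnrm_bsub_self[of a] openin_subset[OF GH(1)] a by auto
    then show ?thesis using GH by (auto simp: disjnt_def)
  next
    case False
    then obtain U V where UV: "openin (base E) U" "openin (base E) V" "proj E x \<in> U" "proj E y \<in> V" "disjnt U V"
      using assms xy proj_in_base unfolding Hausdorff_space_def by metis
    have "openin (total E) {z \<in> topspace (total E). proj E z \<in> U}"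
      "openin (total E) {z \<in> topspace (total E). proj E z \<in> V}"
      using UV openin_continuous_map_preimage[OF proj_continuous] by blast+
    moreover have "disjnt {z \<in> topspace (total E). proj E z \<in> U} {z \<in> topspace (total E). proj E z \<in> V}"
      using UV(5) by (auto simp: disjnt_iff)
    ultimately show ?thesis using UV xy by blast
  qed
qed

end


section \<open>Sections of idempotents\<close>

lemma fibre_subbundle: "fibre (subbundle E S) t = (fibre E t)\<lparr>carr := {x \<in> topspace (total E). x \<in> S \<and> proj E x = t}\<rparr>"
  by (auto simp: fibre_def subbundle_def)

lemma star_iso_matrix_algD:
  assumes "cstar_algebra A" "star_iso A matrix_alg h"
  shows "matrix_cstar_algebra A h"
  using assms by (simp add: matrix_cstar_algebra_def matrix_cstar_algebra_axioms_def)

lemma star_iso_diagonal_alg_iff: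
  "star_iso A diagonal_alg h \<longleftrightarrow> bij_betw h (carr A) diagonal \<and>
     (\<forall>x\<in>carr A. \<forall>y\<in>carr A. h (x \<oplus>\<^bsub>A\<^esub> y) = h x + h y) \<and>
     (\<forall>c. \<forall>x\<in>carr A. h (c \<odot>\<^bsub>A\<^esub> x) = mat_smult c (h x)) \<and>
     (\<forall>x\<in>carr A. \<forall>y\<in>carr A. h (x \<otimes>\<^bsub>A\<^esub> y) = h x ** h y) \<and>
     (\<forall>x\<in>carr A. h (adj\<^bsub>A\<^esub> x) = mat_adj (h x))"
  by (simp add: star_iso_def diagonal_alg_def matrix_alg_def mat_smult_def mat_adj_def)

text \<open>\<open>h\<close> and \<open>g\<close> come from unrelated choices. Pulling the diagonal
  units back along \<open>g\<close> gives projections in \<open>B\<close>; a unitary diagonalizes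
  their images under \<open>h\<close>, and conjugating \<open>h\<close> by it yields an isomorphism
  that agrees with \<open>g\<close> on all of \<open>B\<close>.\<close>

lemma (in cstar_algebra) diagonalizing_iso:
  fixes h :: "'a \<Rightarrow> complex^'n^'n" and g :: "'a \<Rightarrow> complex^'n^'n"
  assumes h: "star_iso A matrix_alg h" and B: "cstar_subalgebra A B"
    and g: "star_iso (A\<lparr>carr := B\<rparr>) diagonal_alg g"
  obtains f :: "'a \<Rightarrow> complex^'n^'n" where "star_iso A matrix_alg f" "f ` B = diagonal"
proof -
  interpret h: matrix_cstar_algebra A h
    using h by (simp add: star_iso_matrix_algD cstar_algebra_axioms)
  interpret B: cstar_algebra "A\<lparr>carr := B\<rparr>"
    using B by (simp add: cstar_subalgebra_def)
  have BA: "x \<in> B \<Longrightarrow> x \<in> carr A" for x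
    using B by (auto simp: cstar_subalgebra_def)
  have g_bij: "bij_betw g B diagonal"
    and g_mul: "\<And>x y. \<lbrakk>x \<in> B; y \<in> B\<rbrakk> \<Longrightarrow> g (x \<otimes> y) = g x ** g y"
    and g_smul: "\<And>c x. x \<in> B \<Longrightarrow> g (c \<odot> x) = mat_smult c (g x)"
    and g_adj: "\<And>x. x \<in> B \<Longrightarrow> g (adj x) = mat_adj (g x)"
    using g by (auto simp: star_iso_diagonal_alg_iff)
  have B_mul: "\<lbrakk>x \<in> B; y \<in> B\<rbrakk> \<Longrightarrow> x \<otimes> y \<in> B" and B_smul: "x \<in> B \<Longrightarrow> c \<odot> x \<in> B"
    and B_adj: "x \<in> B \<Longrightarrow> adj x \<in> B" for x y c
    using B.mul_closed[of x y] B.smul_closed[of x c] B.adj_closed[of x] by auto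
  have g_inj: "\<lbrakk>x \<in> B; y \<in> B; g x = g y\<rbrakk> \<Longrightarrow> x = y" for x y
    using g_bij by (auto simp: bij_betw_def inj_on_def)
  have "mat_unit i i \<in> g ` B" for i
    using g_bij by (simp add: bij_betw_def)
  then have "\<exists>x. x \<in> B \<and> g x = mat_unit i i" for i
    by (metis imageE)
  then obtain e where e: "\<And>i. e i \<in> B" "\<And>i. g (e i) = mat_unit i i"
    by metis
  \<comment> \<open>Zero is written as \<open>0 \<odot> e i\<close> because isomorphisms are
    specified on scalar multiples and not on the zero element.\<close>
  have smul_mul: "e i \<otimes> e j = (if i = j then e i else 0 \<odot> e i)" for i j
    by (rule g_inj) (auto simp: e B_mul B_smul g_mul g_smul mat_unit_mul_mat_unit vec_eq_iff)
  have "e i \<noteq> 0 \<odot> e i" for i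
  proof -
    have "g (e i) $ i $ i \<noteq> g (0 \<odot> e i) $ i $ i"
      by (simp add: g_smul e)
    then show ?thesis by auto
  qed
  then have "h (e i) \<noteq> 0" for i
    using h.h_smul[OF BA[OF e(1)], of 0 i] h.h_inject[of "e i" "0 \<odot> e i"]
    by (auto simp: BA e B_smul vec_eq_iff)
  moreover have "h (e i) ** h (e j) = (if i = j then h (e i) else 0)" for i j
    using smul_mul[of i j] h.h_mul[of "e i" "e j"] by (auto simp: BA e h.h_smul vec_eq_iff)
  moreover have "adj (e i) = e i" for i
    by (rule g_inj) (auto simp: e B_adj g_adj)
  then have "mat_adj (h (e i)) = h (e i)" for i
    using h.h_adj[OF BA[OF e(1)], of i] by simp
  ultimately obtain U where U: "U ** mat_adj U = mat 1" "mat_adj U ** U = mat 1"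
    "\<And>i. mat_adj U ** h (e i) ** U = mat_unit i i"
    using orthogonal_projections_unitary[of "\<lambda>i. h (e i)"] by metis
  define f where "f x = mat_adj U ** h x ** U" for x
  have f: "star_iso A matrix_alg f"
    unfolding f_def by (rule star_iso_unitary_conj[OF h U(1,2)])
  interpret f: matrix_cstar_algebra A f
    using f by (simp add: star_iso_matrix_algD cstar_algebra_axioms)
  have f_e: "f (e i) = mat_unit i i" for i
    by (simp add: f_def U)
  have "f b = g b" if b: "b \<in> B" for b
  proof -
    have gb: "g b \<in> diagonal" using g_bij b by (auto simp: bij_betw_def)
    \<comment> \<open>This relation in \<open>B\<close> can be read through \<open>f\<close> as well
      as through \<open>g\<close>, and it determines column \<open>j\<close> of
      \<open>f b\<close>.\<close>
    have "b \<otimes> e j = (g b $ j $ j) \<odot> e j" for j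
      by (rule g_inj) (auto simp: b e B_mul B_smul g_mul g_smul vec_eq_iff diagonal_mul_nth[OF gb] mat_unit_nth)
    then have "f b ** mat_unit j j = mat_smult (g b $ j $ j) (mat_unit j j)" for j
      using f.h_mul[of b "e j"] f.h_smul[of "e j"] by (simp add: f_e BA b e)
    then have "(f b ** mat_unit j j) $ i $ j = (mat_smult (g b $ j $ j) (mat_unit j j)) $ i $ j" for i j
      by simp
    then have "f b $ i $ j = g b $ i $ j" for i j
      using diagonalD[OF gb, of i j] by (cases "i = j") (auto simp: mul_mat_unit_nth mat_unit_nth)
    then show ?thesis by (rule mat_eqI)
  qed
  then have "f ` B = g ` B" by simp
  then have "f ` B = diagonal" using g_bij by (simp add: bij_betw_def)
  then show ?thesis using that f by blast
qed

text \<open>The frames \<open>h t\<close> are arbitrary choices over each point, without any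
  continuity in \<open>t\<close>. They serve to compute inside a single fibre.\<close>

locale framed_bundle = cstar_bundle E for E :: "('t, 'e) star_bundle" +
  fixes S :: "'e set" and h :: "'t \<Rightarrow> 'e \<Rightarrow> complex^'n^'n"
  assumes sub_bundle: "sub_cstar_bundle E S"
    and frame: "t \<in> topspace (base E) \<Longrightarrow> star_iso (fibre E t) matrix_alg (h t)"
    and frame_sub: "t \<in> topspace (base E) \<Longrightarrow> h t ` {x \<in> S. proj E x = t} = diagonal"
begin

lemma matrix_fibre: "t \<in> topspace (base E) \<Longrightarrow> matrix_cstar_algebra (fibre E t) (h t)"
  by (simp add: star_iso_matrix_algD fibre_cstar frame)

lemma S_total: "x \<in> S \<Longrightarrow> x \<in> topspace (total E)"
  using sub_bundle by (auto simp: sub_cstar_bundle_def)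

lemma S_base: "x \<in> S \<Longrightarrow> proj E x \<in> topspace (base E)"
  by (simp add: S_total proj_in_base)

lemma diagonal_of_S: "x \<in> S \<Longrightarrow> h (proj E x) x \<in> diagonal"
  using frame_sub[OF S_base] by blast

lemma S_of_diagonal:
  assumes "x \<in> topspace (total E)" "h (proj E x) x \<in> diagonal"
  shows "x \<in> S"
proof -
  interpret F: matrix_cstar_algebra "fibre E (proj E x)" "h (proj E x)"
    by (simp add: matrix_fibre proj_in_base assms)
  have "h (proj E x) x \<in> h (proj E x) ` {y \<in> S. proj E y = proj E x}"
    using assms(2) unfolding frame_sub[OF proj_in_base[OF assms(1)]] .
  then obtain y where y: "y \<in> S" "proj E y = proj E x" "h (proj E x) x = h (proj E x) y"
    by blast
  have "x = y" by (rule F.h_inject[THEN iffD1, OF _ _ y(3)]) (use assms(1) S_total y in simp_all)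
  then show ?thesis using y by simp
qed

text \<open>Openness on the sub-bundle itself, and not just on the total space, is what produces
  elements of \<open>S\<close> over neighbouring points.\<close>

lemma proj_open_S:
  assumes "openin (total E) V"
  shows "openin (base E) (proj E ` (V \<inter> S))"
proof -
  interpret S: cstar_bundle "subbundle E S"
    using sub_bundle by (simp add: sub_cstar_bundle_def)
  have "open_map (subtopology (total E) S) (base E) (proj E)"
    using S.proj_open by (simp add: subbundle_def)
  then show ?thesis
    using assms by (simp add: open_map_def openin_subtopology_Int)
qed

text \<open>The idempotent is obtained by rounding the diagonal entries of \<open>x\<close> to 0 or 1.\<close>

lemma idempotent_rounding:
  assumes x: "x \<in> S" and e: "0 < e"
    and small: "bnrm E (bsub E (bmul E x x) x) < (e / (2 * real CARD('n)))\<^sup>2"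
  obtains y where "y \<in> topspace (total E)" "proj E y = proj E x" "bnrm E y < e"
    "badd E x y \<in> S" "bmul E (badd E x y) (badd E x y) = badd E x y"
proof -
  let ?s = "proj E x"
  interpret F: matrix_cstar_algebra "fibre E ?s" "h ?s"
    by (simp add: matrix_fibre S_base x)
  \<comment> \<open>Moving each of the \<open>CARD('n)\<close> diagonal entries by at most
    \<open>d\<close> changes the norm by at most e / 2, according to
    \<open>nrm_diagonal_le\<close>.\<close>
  define d where "d = e / (2 * real CARD('n))"
  have d: "d > 0" using e by (simp add: d_def)
  have hx: "h ?s x \<in> diagonal" by (rule diagonal_of_S[OF x])
  have xc: "x \<in> carr (fibre E ?s)" using S_total x by simp
  have xx: "bmul E x x \<in> carr (fibre E ?s)" using F.mul_closed[OF xc xc] by simp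
  let ?D = "\<lambda>i. h ?s x $ i $ i"
  \<comment> \<open>For an entry z, the modulus of z * z - z is the product of the distances of z to
    0 and to 1. If both exceeded \<open>d\<close>, the product would exceed d * d, against
    \<open>small\<close>.\<close>
  have "\<exists>r. r * r = r \<and> cmod (r - ?D i) \<le> d" for i
  proof (rule ccontr)
    assume "\<not> ?thesis"
    then have "d < cmod (0 - ?D i)" "d < cmod (1 - ?D i)"
      by (metis linorder_not_le mult_zero_left, metis linorder_not_le mult_1)
    then have "d * d < cmod (0 - ?D i) * cmod (1 - ?D i)"
      using d by (intro mult_strict_mono) auto
    also have "\<dots> = cmod (?D i * ?D i - ?D i)"
      by (simp add: norm_minus_commute algebra_simps flip: norm_mult)
    also have "\<dots> = cmod (h ?s (bsub E (bmul E x x) x) $ i $ i)"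
      using F.h_sub[OF xx xc] F.h_mul[OF xc xc] by (simp add: diagonal_mul_nth[OF hx])
    also have "\<dots> \<le> bnrm E (bsub E (bmul E x x) x)"
      using F.entry_le_nrm[OF F.sub_closed[OF xx xc]] by simp
    also have "\<dots> < d * d"
      using small by (simp add: d_def power2_eq_square)
    finally show False .
  qed
  then obtain r where r: "\<And>i. r i * r i = r i" "\<And>i. cmod (r i - ?D i) \<le> d" by metis
  define R :: "complex^'n^'n" where "R = (\<chi> i j. if i = j then r i else 0)"
  have R: "R \<in> diagonal" by (rule diagonalI) (simp add: R_def)
  define y where "y = F.k (R - h ?s x)"
  have y: "y \<in> carr (fibre E ?s)" by (simp only: y_def F.k_closed)
  have hy: "h ?s y = R - h ?s x" by (simp add: y_def del: fibre_simps)
  have q: "h ?s (badd E x y) = R"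
    using F.h_add[OF xc y] hy by simp
  have qc: "badd E x y \<in> carr (fibre E ?s)"
    using F.add_closed[OF xc y] by simp
  have "(R ** R) $ i $ j = R $ i $ j" for i j
    unfolding diagonal_mul_nth[OF R] using r(1)[of i] by (auto simp: R_def)
  then have "R ** R = R" by (rule mat_eqI)
  then have "h ?s (bmul E (badd E x y) (badd E x y)) = R"
    using F.h_mul[OF qc qc] q by simp
  then have idem: "bmul E (badd E x y) (badd E x y) = badd E x y"
    using F.h_inject[OF F.mul_closed[OF qc qc] qc] q by simp
  have "h ?s y \<in> diagonal"
    by (rule diagonalI) (simp add: hy diagonalD[OF R] diagonalD[OF hx])
  then have "bnrm E y \<le> (\<Sum>i\<in>UNIV. cmod (h ?s y $ i $ i))"
    using F.nrm_diagonal_le[OF y] by simp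
  also have "\<dots> \<le> (\<Sum>i\<in>(UNIV::'n set). d)"
    using r by (intro sum_mono) (simp add: hy R_def)
  also have "\<dots> < e" using e by (simp add: d_def)
  finally have "bnrm E y < e" .
  moreover have "badd E x y \<in> S"
    using qc q R by (intro S_of_diagonal) auto
  ultimately show ?thesis using that y idem by auto
qed

text \<open>Elements of \<open>S\<close> near \<open>p\<close> are almost idempotent because
  \<open>p\<close> is idempotent, and rounding adds a small correction \<open>y\<close>. As p + 0 =
  p, continuity of addition keeps the corrected element in \<open>V\<close>; the zero neighbourhood
  axiom turns the small norm of \<open>y\<close> into membership in \<open>H\<close>.\<close>

lemma idempotent_near:
  assumes p: "p \<in> S" "bmul E p p = p" and V: "openin (total E) V" "p \<in> V"
  obtains U where "openin (base E) U" "proj E p \<in> U"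
    "\<And>s. s \<in> U \<Longrightarrow> \<exists>q\<in>V \<inter> S. proj E q = s \<and> bmul E q q = q"
proof -
  let ?t = "proj E p"
  have t: "?t \<in> topspace (base E)" and pT: "p \<in> topspace (total E)"
    by (simp_all add: S_base S_total p)
  interpret F: cstar_algebra "fibre E ?t" by (simp add: fibre_cstar t)
  have z: "bzero E ?t \<in> topspace (total E)" "proj E (bzero E ?t) = ?t"
    using F.zero_closed by auto
  have "badd E p (bzero E ?t) = p" using F.add_zero[of p] pT by simp
  then obtain G H where GH: "openin (total E) G" "openin (total E) H" "p \<in> G" "bzero E ?t \<in> H"
    "\<And>a b. \<lbrakk>a \<in> G; b \<in> H; proj E a = proj E b\<rbrakk> \<Longrightarrow> (\<lambda>(x, y). badd E x y) (a, b) \<in> V"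
    using fibre_product_neighbourhood[OF add_continuous V(1), of p "bzero E ?t"] pT z V(2) by auto
  obtain U e where U: "openin (base E) U" "?t \<in> U" "0 < e"
    "{x \<in> topspace (total E). proj E x \<in> U \<and> bnrm E x < e} \<subseteq> H"
    using zero_neighbourhood[OF t GH(2,4)] by blast
  \<comment> \<open>The threshold in \<open>idempotent_rounding\<close> for a correction of norm
    below \<open>e\<close>.\<close>
  define c where "c = (e / (2 * real CARD('n)))\<^sup>2"
  have c: "c > 0" using U by (simp add: c_def)
  have "continuous_map (total E) euclideanreal (\<lambda>x. bnrm E (bsub E (bmul E x x) x))"
    by (intro continuous_map_bnrm continuous_map_bsub continuous_map_bmul) (auto simp: proj_bmul)
  then have "openin (total E) {x \<in> topspace (total E). bnrm E (bsub E (bmul E x x) x) \<in> {..<c}}"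
    by (rule openin_continuous_map_preimage) (simp flip: open_openin)
  then have G': "openin (total E) (G \<inter> {x \<in> topspace (total E). bnrm E (bsub E (bmul E x x) x) \<in> {..<c}})"
    (is "openin _ ?G")
    using GH by blast
  have pG: "p \<in> ?G" using GH pT c p by (simp add: bnrm_bsub_self)
  let ?U = "U \<inter> proj E ` (?G \<inter> S)"
  show ?thesis
  proof
    show "openin (base E) ?U" using U proj_open_S[OF G'] by blast
    show "?t \<in> ?U" using U pG p by blast
    fix s assume "s \<in> ?U"
    then obtain x where x: "x \<in> ?G" "x \<in> S" "proj E x = s" "s \<in> U" by blast
    then have "bnrm E (bsub E (bmul E x x) x) < (e / (2 * real CARD('n)))\<^sup>2"
      by (simp add: c_def)
    then obtain y where y: "y \<in> topspace (total E)" "proj E y = proj E x" "bnrm E y < e"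
      "badd E x y \<in> S" "bmul E (badd E x y) (badd E x y) = badd E x y"
      using idempotent_rounding[OF x(2) U(3)] by metis
    have "y \<in> H" using U(4) y x by auto
    then have "badd E x y \<in> V" using GH(5)[of x y] x y by auto
    moreover have "proj E (badd E x y) = s"
      using proj_badd[of x y] x y S_total by simp
    ultimately show "\<exists>q\<in>V \<inter> S. proj E q = s \<and> bmul E q q = q" using y by blast
  qed
qed

lemma idempotent_entry:
  assumes "q \<in> S" "bmul E q q = q"
  shows "h (proj E q) q $ i $ i = 0 \<or> h (proj E q) q $ i $ i = 1"
proof -
  interpret F: matrix_cstar_algebra "fibre E (proj E q)" "h (proj E q)"
    by (simp add: matrix_fibre S_base assms)
  have "h (proj E q) q $ i $ i * h (proj E q) q $ i $ i = h (proj E q) q $ i $ i"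
    using F.h_mul[of q q] assms S_total[of q] diagonal_mul_nth[OF diagonal_of_S[OF assms(1)], of "h (proj E q) q" i i]
    by simp
  then show ?thesis by simp
qed

text \<open>In a frame both idempotents are diagonal with entries 0 or 1. Differences of entries are
  bounded by the norm, and two such numbers at distance below 1 agree.\<close>

lemma idempotent_unique:
  assumes q: "q \<in> S" "bmul E q q = q" and q': "q' \<in> S" "bmul E q' q' = q'"
    and s: "proj E q = proj E q'" and near: "bnrm E (bsub E q q') < 1"
  shows "q = q'"
proof -
  let ?s = "proj E q'"
  interpret F: matrix_cstar_algebra "fibre E ?s" "h ?s"
    by (simp add: matrix_fibre S_base q')
  have c: "q \<in> carr (fibre E ?s)" "q' \<in> carr (fibre E ?s)"
    using q q' s S_total by auto
  have "cmod (h ?s q $ i $ i - h ?s q' $ i $ i) < 1" for i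
    using F.entry_le_nrm[OF F.sub_closed[OF c], of i i] F.h_sub[OF c] near by simp
  moreover have "h ?s q $ i $ i = 0 \<or> h ?s q $ i $ i = 1" "h ?s q' $ i $ i = 0 \<or> h ?s q' $ i $ i = 1" for i
    using idempotent_entry[OF q, of i] idempotent_entry[OF q', of i] s by auto
  ultimately have diag: "h ?s q $ i $ i = h ?s q' $ i $ i" for i
    by (metis diff_zero norm_minus_commute norm_one order_less_irrefl)
  have "h ?s q \<in> diagonal" "h ?s q' \<in> diagonal"
    using diagonal_of_S[OF q(1)] diagonal_of_S[OF q'(1)] s by auto
  then have "h ?s q $ i $ j = h ?s q' $ i $ j" for i j
    using diag by (cases "i = j") (auto simp: diagonalD)
  then have "h ?s q = h ?s q'" by (rule mat_eqI)
  then show ?thesis using F.h_inject[OF c] by simp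
qed

text \<open>Fibrewise distances inside \<open>V\<close> are below 1, so \<open>V\<close> contains at
  most one idempotent of \<open>S\<close> over each point. This uniqueness makes a pointwise choice
  continuous.\<close>

lemma idempotent_section:
  assumes p: "p \<in> S" "bmul E p p = p"
  obtains U q where "openin (base E) U" "proj E p \<in> U" "q (proj E p) = p"
    "continuous_map (subtopology (base E) U) (total E) q"
    "\<And>s. s \<in> U \<Longrightarrow> q s \<in> S \<and> proj E (q s) = s \<and> bmul E (q s) (q s) = q s"
proof -
  have pT: "p \<in> topspace (total E)" by (simp add: S_total p)
  then obtain G H where GH: "openin (total E) G" "openin (total E) H" "p \<in> G" "p \<in> H"
    "\<And>a b. \<lbrakk>a \<in> G; b \<in> H; proj E a = proj E b\<rbrakk> \<Longrightarrow> (\<lambda>(x, y). bnrm E (bsub E x y)) (a, b) \<in> {..<1}"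
    using fibre_product_neighbourhood[OF continuous_map_fibre_distance, of "{..<1}" p p]
    by (auto simp: bnrm_bsub_self simp flip: open_openin)
  define V where "V = G \<inter> H"
  have V: "openin (total E) V" "p \<in> V" using GH by (auto simp: V_def)
  have unique: "a = b" if "a \<in> V \<inter> S" "b \<in> V \<inter> S" "proj E a = proj E b" "bmul E a a = a" "bmul E b b = b" for a b
    using idempotent_unique[of a b] GH(5)[of a b] that by (auto simp: V_def)
  obtain U where U: "openin (base E) U" "proj E p \<in> U"
    "\<And>s. s \<in> U \<Longrightarrow> \<exists>q\<in>V \<inter> S. proj E q = s \<and> bmul E q q = q"
    using idempotent_near[OF p V] by metis
  then obtain q where q: "\<And>s. s \<in> U \<Longrightarrow> q s \<in> V \<inter> S \<and> proj E (q s) = s \<and> bmul E (q s) (q s) = q s"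
    by metis
  have "continuous_map (subtopology (base E) U) (total E) q"
    unfolding continuous_map_def
  proof (intro conjI allI impI)
    show "q \<in> topspace (subtopology (base E) U) \<rightarrow> topspace (total E)"
      using q S_total by auto
    fix O' assume O': "openin (total E) O'"
    let ?I = "{x \<in> topspace (subtopology (base E) U). q x \<in> O'}"
    have "\<exists>T. openin (base E) T \<and> s \<in> T \<and> T \<subseteq> ?I" if s: "s \<in> ?I" for s
    proof -
      have sU: "s \<in> U" using s by simp
      \<comment> \<open>Nearby fibres contain an idempotent in the smaller set
        \<open>V \<inter> O'\<close>. By uniqueness in \<open>V\<close> it is the value of
        \<open>q\<close>, which therefore lies in \<open>O'\<close>.\<close>
      obtain T where T: "openin (base E) T" "proj E (q s) \<in> T"
        "\<And>r. r \<in> T \<Longrightarrow> \<exists>q'\<in>(V \<inter> O') \<inter> S. proj E q' = r \<and> bmul E q' q' = q'"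
        using idempotent_near[of "q s" "V \<inter> O'"] q[OF sU] V O' s by blast
      have "r \<in> ?I" if r: "r \<in> T \<inter> U" for r
      proof -
        obtain q' where q': "q' \<in> (V \<inter> O') \<inter> S" "proj E q' = r" "bmul E q' q' = q'"
          using T(3) r by blast
        have "q' = q r" by (rule unique) (use q' q[of r] r in auto)
        then show ?thesis using q' r openin_subset[OF U(1)] by auto
      qed
      moreover have "openin (base E) (T \<inter> U)" "s \<in> T \<inter> U" using T U q[OF sU] sU by auto
      ultimately show ?thesis by blast
    qed
    then have "openin (base E) ?I" by (subst openin_subopen) blast
    then show "openin (subtopology (base E) U) ?I"
      using openin_open_subtopology[OF U(1)] by auto
  qed
  moreover have "q (proj E p) = p"
    using unique[of "q (proj E p)" p] q[OF U(2)] p V by auto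
  ultimately show ?thesis using that[of U q] U q by blast
qed

end

text \<open>Each \<open>q i\<close> is the indicator of a set of indices, nonempty because the norm
  is positive and disjoint from the others because a shared index would give the product an entry 1.
  With as many sets as indices all are singletons, and a permutation sorts them. The two norm
  conditions are strict inequalities, so they persist at neighbouring points.\<close>

lemma (in framed_bundle) permuted_frame:
  fixes q :: "'n \<Rightarrow> 'e"
  assumes s: "s \<in> topspace (base E)" and q: "\<And>i. q i \<in> S" "\<And>i. proj E (q i) = s" "\<And>i. bmul E (q i) (q i) = q i"
    and nz: "\<And>i. bnrm E (q i) > 0" and orth: "\<And>i j. i \<noteq> j \<Longrightarrow> bnrm E (bmul E (q i) (q j)) < 1"
  obtains f where "star_iso (fibre E s) matrix_alg f" "f ` {x \<in> S. proj E x = s} = diagonal"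
    "\<And>i. f (q i) = mat_unit i i"
proof -
  interpret F: matrix_cstar_algebra "fibre E s" "h s" by (rule matrix_fibre[OF s])
  have c: "q i \<in> carr (fibre E s)" for i using q S_total by simp
  have diag: "h s (q i) \<in> diagonal" for i using diagonal_of_S[OF q(1)[of i]] q by simp
  have entry: "h s (q i) $ a $ a = 0 \<or> h s (q i) $ a $ a = 1" for i a
    using idempotent_entry[OF q(1,3), of i a] q by simp
  have "\<exists>a. h s (q i) $ a $ a = 1" for i
  proof (rule ccontr)
    assume "\<nexists>a. h s (q i) $ a $ a = 1"
    then have "h s (q i) $ a $ b = 0" for a b
      using entry[of i] diagonalD[OF diag[of i], of a b] by (cases "a = b") auto
    then have "h s (q i) = 0" by (simp add: vec_eq_iff)
    then have "q i = bzero E s"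
      using F.h_inject[OF c F.zero_closed, of i] F.h_zero by simp
    then show False using nz[of i] bnrm_zero[OF s] by simp
  qed
  then obtain p where p: "\<And>i. h s (q i) $ p i $ p i = 1" by metis
  have disj: "i = j" if "h s (q i) $ a $ a = 1" "h s (q j) $ a $ a = 1" for i j a
  proof (rule ccontr)
    assume "i \<noteq> j"
    have "cmod (h s (bmul E (q i) (q j)) $ a $ a) \<le> bnrm E (bmul E (q i) (q j))"
      using F.entry_le_nrm[OF F.mul_closed[OF c c]] by simp
    moreover have "h s (bmul E (q i) (q j)) $ a $ a = 1"
      using F.h_mul[OF c c, of i j] that by (simp add: diagonal_mul_nth[OF diag])
    ultimately show False using orth[OF \<open>i \<noteq> j\<close>] by simp
  qed
  have "inj p" by (rule injI) (metis disj p)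
  then have bij: "bij p" by (simp add: bij_def finite_UNIV_inj_surj)
  then have p_eq: "p a = p b \<longleftrightarrow> a = b" for a b by (simp add: bij_is_inj inj_eq)
  have hq: "h s (q i) $ p a $ p b = (if a = i \<and> b = i then 1 else 0)" for i a b
  proof (cases "a = b")
    case True
    then show ?thesis using p[of i] entry[of i "p a"] disj[of i "p a" a] p[of a] by auto
  next
    case False
    then show ?thesis using diagonalD[OF diag[of i], of "p a" "p b"] by (auto simp: p_eq)
  qed
  let ?P = "\<lambda>M :: complex^'n^'n. (\<chi> a b. M $ p a $ p b) :: complex^'n^'n"
  let ?f = "\<lambda>x. ?P (h s x)"
  have "?f ` {x \<in> S. proj E x = s} = ?P ` diagonal"
    by (simp only: image_image flip: frame_sub[OF s])
  also have "\<dots> = diagonal"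
  proof
    show "?P ` diagonal \<subseteq> diagonal"
      by (auto intro!: diagonalI simp: diagonalD p_eq)
    show "diagonal \<subseteq> ?P ` diagonal"
    proof
      fix M :: "complex^'n^'n" assume M: "M \<in> diagonal"
      have "inv p a = inv p b \<longleftrightarrow> a = b" for a b
        using bij by (metis bij_inv_eq_iff)
      then have "(\<chi> a b. M $ inv p a $ inv p b) \<in> diagonal"
        by (intro diagonalI) (simp add: diagonalD[OF M])
      moreover have "M = ?P (\<chi> a b. M $ inv p a $ inv p b)"
        using bij by (simp add: vec_eq_iff bij_is_inj)
      ultimately show "M \<in> ?P ` diagonal" by blast
    qed
  qed
  finally have "?f ` {x \<in> S. proj E x = s} = diagonal" .
  moreover have "?f (q i) = mat_unit i i" for i
    by (rule mat_eqI) (simp add: hq mat_unit_nth)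
  ultimately show ?thesis
    using that star_iso_permute[OF frame[OF s] bij] by blast
qed

text \<open>Only the idempotents are extended continuously. The frame \<open>f s\<close> adapted to
  them is still chosen separately over each point, so its phases are arbitrary.\<close>

lemma (in framed_bundle) local_diagonal_frame:
  assumes t: "t \<in> topspace (base E)"
  obtains W and q :: "'n \<Rightarrow> 't \<Rightarrow> 'e" and f :: "'t \<Rightarrow> 'e \<Rightarrow> complex^'n^'n"
  where "openin (base E) W" "t \<in> W" "\<And>i. continuous_map (subtopology (base E) W) (total E) (q i)"
    "\<And>i s. s \<in> W \<Longrightarrow> q i s \<in> topspace (total E) \<and> proj E (q i s) = s \<and> f s (q i s) = mat_unit i i"
    "\<And>s. s \<in> W \<Longrightarrow> star_iso (fibre E s) matrix_alg (f s)"
    "\<And>s. s \<in> W \<Longrightarrow> f s ` {x \<in> S. proj E x = s} = diagonal"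
proof -
  interpret F: matrix_cstar_algebra "fibre E t" "h t" by (rule matrix_fibre[OF t])
  define p where "p i = F.k (mat_unit i i)" for i
  have pc: "p i \<in> carr (fibre E t)" for i by (simp only: p_def F.k_closed)
  then have pT: "p i \<in> topspace (total E)" "proj E (p i) = t" for i by auto
  have hp: "h t (p i) = mat_unit i i" for i by (simp only: p_def F.h_k)
  have pS: "p i \<in> S" for i
    by (rule S_of_diagonal) (simp_all add: pT hp)
  have pp: "bmul E (p i) (p j) = (if i = j then p i else bzero E t)" for i j
  proof -
    have "h t (bmul E (p i) (p j)) = h t (if i = j then p i else bzero E t)"
      using F.h_mul[OF pc pc, of i j] F.h_zero by (simp add: hp mat_unit_mul_mat_unit)
    then show ?thesis
      using F.h_inject[OF F.mul_closed[OF pc pc]] pc F.zero_closed by (auto split: if_splits)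
  qed
  have "\<exists>U q. openin (base E) U \<and> t \<in> U \<and> q t = p i \<and> continuous_map (subtopology (base E) U) (total E) q \<and>
      (\<forall>s\<in>U. q s \<in> S \<and> proj E (q s) = s \<and> bmul E (q s) (q s) = q s)" for i
  proof -
    have "bmul E (p i) (p i) = p i" by (simp add: pp)
    from idempotent_section[OF pS this] show ?thesis unfolding pT by metis
  qed
  then obtain U q where U: "\<And>i. openin (base E) (U i)" "\<And>i. t \<in> U i" "\<And>i. q i t = p i"
    and q_cont: "\<And>i. continuous_map (subtopology (base E) (U i)) (total E) (q i)"
    and q: "\<And>i s. s \<in> U i \<Longrightarrow> q i s \<in> S \<and> proj E (q i s) = s \<and> bmul E (q i s) (q i s) = q i s"
    by metis
  define W0 where "W0 = (\<Inter>i. U i)"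
  have W0: "openin (base E) W0" "t \<in> W0"
    using U by (auto simp: W0_def intro!: openin_INT2)
  let ?X = "subtopology (base E) W0"
  have X: "topspace ?X = W0" using openin_subset[OF W0(1)] by auto
  have q_cont: "continuous_map ?X (total E) (q i)" for i
    by (rule continuous_map_from_subtopology_mono[OF q_cont]) (auto simp: W0_def)
  have q: "q i s \<in> S" "proj E (q i s) = s" "bmul E (q i s) (q i s) = q i s" if "s \<in> W0" for i s
    using q[of s i] that by (auto simp: W0_def)
  have op: "openin (base E) {s \<in> W0. g s \<in> V}" if g: "continuous_map ?X euclideanreal g" and V: "open V" for g V
    using openin_continuous_map_preimage[OF g, of V] V unfolding X openin_open_subtopology[OF W0(1)] by simp
  \<comment> \<open>At \<open>t\<close> each \<open>q i\<close> has norm 1 and each product of two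
    different ones is zero, so these open conditions hold there and hence near
    \<open>t\<close>.\<close>
  define A where "A i = {s \<in> W0. bnrm E (q i s) \<in> {0<..}}" for i
  define B where "B i j = {s \<in> W0. i \<noteq> j \<longrightarrow> bnrm E (bmul E (q i s) (q j s)) \<in> {..<1}}" for i j
  have A: "openin (base E) (A i)" for i
    unfolding A_def by (intro op continuous_map_bnrm q_cont) simp
  have "openin (base E) {s \<in> W0. bnrm E (bmul E (q i s) (q j s)) \<in> {..<1}}" for i j
    by (intro op continuous_map_bnrm continuous_map_bmul q_cont) (auto simp: X q)
  then have B: "openin (base E) (B i j)" for i j
    using W0 by (cases "i = j") (simp_all add: B_def)
  define W where "W = (\<Inter>i. A i) \<inter> (\<Inter>i. \<Inter>j. B i j)"
  have W: "openin (base E) W"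
    unfolding W_def by (intro openin_Int openin_INT2 A B) auto
  have WW0: "W \<subseteq> W0" by (auto simp: W_def A_def)
  have "bnrm E (p i) = 1" for i
    using F.nrm_mat_unit[of i i] by (simp add: p_def)
  then have tW: "t \<in> W"
    using W0 by (simp add: W_def A_def B_def U pp bnrm_zero t)
  have "\<forall>s\<in>W. \<exists>f. star_iso (fibre E s) matrix_alg f \<and> f ` {x \<in> S. proj E x = s} = diagonal \<and>
      (\<forall>i. f (q i s) = mat_unit i i)"
  proof
    fix s assume s: "s \<in> W"
    show "\<exists>f. star_iso (fibre E s) matrix_alg f \<and> f ` {x \<in> S. proj E x = s} = diagonal \<and>
      (\<forall>i. f (q i s) = mat_unit i i)"
    proof (rule permuted_frame[of s "\<lambda>i. q i s"])
      show "s \<in> topspace (base E)" using s W openin_subset by blast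
      show "q i s \<in> S" "proj E (q i s) = s" "bmul E (q i s) (q i s) = q i s" for i
        using q s WW0 by auto
      show "0 < bnrm E (q i s)" for i using s by (auto simp: W_def A_def)
      show "bnrm E (bmul E (q i s) (q j s)) < 1" if "i \<noteq> j" for i j
        using s that by (auto simp: W_def B_def)
    qed blast
  qed
  from bchoice[OF this]
  obtain f where f: "\<And>s. s \<in> W \<Longrightarrow> star_iso (fibre E s) matrix_alg (f s)"
    "\<And>s. s \<in> W \<Longrightarrow> f s ` {x \<in> S. proj E x = s} = diagonal"
    "\<And>s i. s \<in> W \<Longrightarrow> f s (q i s) = mat_unit i i"
    by blast
  have "continuous_map (subtopology (base E) W) (total E) (q i)" for i
    by (rule continuous_map_from_subtopology_mono[OF q_cont WW0])
  moreover have "q i s \<in> topspace (total E) \<and> proj E (q i s) = s \<and> f s (q i s) = mat_unit i i"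
    if "s \<in> W" for i s
    using q[of s i] f(3)[OF that] S_total that WW0 by blast
  ultimately show ?thesis using that[OF W tW] f by blast
qed


section \<open>Sections of matrix units\<close>

context cstar_bundle
begin

text \<open>The corner between \<open>q i\<close> and \<open>q j\<close> is a complex line in each
  fibre, so its unit vectors form a single free orbit of the circle. The hypothesis of
  \<open>local_section\<close> that takes work is openness of the projection of this circle bundle;
  \<open>open_near\<close> provides it.\<close>

lemma normalized_section:
  fixes f :: "'t \<Rightarrow> 'e \<Rightarrow> complex^'n^'n" and q :: "'n \<Rightarrow> 't \<Rightarrow> 'e"
  assumes base: "locally_compact_space (base E)" "Hausdorff_space (base E)"
    and W: "openin (base E) W" and frame: "\<And>s. s \<in> W \<Longrightarrow> star_iso (fibre E s) matrix_alg (f s)"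
    and q_cont: "\<And>i. continuous_map (subtopology (base E) W) (total E) (q i)"
    and q: "\<And>i s. s \<in> W \<Longrightarrow> q i s \<in> topspace (total E) \<and> proj E (q i s) = s \<and> f s (q i s) = mat_unit i i"
    and t: "t \<in> W"
  obtains V v where "openin (base E) V" "t \<in> V" "V \<subseteq> W" "continuous_map (subtopology (base E) V) (total E) v"
    "\<And>s. s \<in> V \<Longrightarrow> v s \<in> topspace (total E) \<and> proj E (v s) = s \<and>
      (\<exists>c. cmod c = 1 \<and> f s (v s) = mat_smult c (mat_unit i j))"
proof -
  have W_base: "W \<subseteq> topspace (base E)" using W openin_subset by blast
  have fib: "matrix_cstar_algebra (fibre E s) (f s)" if "s \<in> W" for s
    using that W_base by (auto simp: matrix_cstar_algebra_def matrix_cstar_algebra_axioms_def fibre_cstar frame)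
  text \<open>The unit circle bundle of the line bundle \<open>q i \<A> q j\<close>.\<close>
  define Z where "Z = {x \<in> topspace (total E). proj E x \<in> W \<and>
    (\<exists>c. cmod c = 1 \<and> f (proj E x) x = mat_smult c (mat_unit i j))}"
  define P where "P = subtopology (total E) Z"
  have P: "topspace P = Z" by (auto simp: P_def Z_def)
  let ?X = "subtopology (base E) W"
  have X: "topspace ?X = W" using W_base by auto
  have f_smul: "f (proj E x) (bsmul E c x) = mat_smult c (f (proj E x) x)"
    if "x \<in> topspace (total E)" "proj E x \<in> W" for c x
  proof -
    interpret F: matrix_cstar_algebra "fibre E (proj E x)" "f (proj E x)" by (rule fib[OF that(2)])
    show ?thesis using F.h_smul[of x c] that by simp
  qed
  have Z_act: "bsmul E c x \<in> Z" if cx: "cmod c = 1" "x \<in> Z" for c x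
  proof -
    obtain d where d: "cmod d = 1" "f (proj E x) x = mat_smult d (mat_unit i j)"
      using cx by (auto simp: Z_def)
    then have "f (proj E x) (bsmul E c x) = mat_smult (c * d) (mat_unit i j)"
      using cx f_smul[of x c] by (simp add: Z_def vec_eq_iff)
    moreover have "cmod (c * d) = 1" using cx d by (simp add: norm_mult)
    ultimately show ?thesis
      using cx by (auto simp: Z_def bsmul_total proj_bsmul)
  qed
  interpret circle_action P "bsmul E"
  proof
    let ?S = "top_of_set (sphere (0::complex) 1)"
    have "continuous_map (prod_topology ?S P) (total E) (\<lambda>p. bsmul E (fst p) (snd p))"
    proof (rule continuous_map_bsmul)
      show "continuous_map (prod_topology ?S P) euclidean fst"
        using continuous_map_fst[of ?S P] by (simp add: continuous_map_in_subtopology)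
      show "continuous_map (prod_topology ?S P) (total E) snd"
        using continuous_map_snd[of ?S P] by (simp add: P_def continuous_map_in_subtopology)
    qed
    then have "continuous_map (prod_topology ?S P) (subtopology (total E) Z) (\<lambda>p. bsmul E (fst p) (snd p))"
      by (rule continuous_map_into_subtopology) (auto simp: P Z_act)
    then show "continuous_map (prod_topology ?S P) P (\<lambda>(c, x). bsmul E c x)"
      by (simp add: P_def[symmetric] case_prod_unfold)
    show "bsmul E c (bsmul E d x) = bsmul E (c * d) x" if "x \<in> topspace P" for c d x
      using cstar_algebra.smul_smul[OF fibre_of, of x x c d] that by (simp add: P Z_def)
    show "bsmul E 1 x = x" if "x \<in> topspace P" for x
      using cstar_algebra.one_smul[OF fibre_of, of x x] that by (simp add: P Z_def)
  qed
  \<comment> \<open>Points of the total space near \<open>x0\<close> are moved into \<open>Z\<close>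
    by a continuous map \<open>\<phi>\<close> that preserves fibres and fixes \<open>x0\<close>. A
    point that \<open>\<phi>\<close> sends into \<open>G\<close> shows that its fibre meets
    \<open>G \<inter> Z\<close>, so openness of the projection on the total space carries
    over.\<close>
  have open_near: "\<exists>T. openin (base E) T \<and> proj E x0 \<in> T \<and> T \<subseteq> proj E ` (G \<inter> Z)"
    if x0: "x0 \<in> G" "x0 \<in> Z" and G: "openin (total E) G" for x0 G
  proof -
    let ?Y = "subtopology (total E) {x \<in> topspace (total E). proj E x \<in> W}"
    have Yop: "openin (total E) {x \<in> topspace (total E). proj E x \<in> W}"
      by (rule openin_continuous_map_preimage[OF proj_continuous W])
    have Y: "topspace ?Y = {x \<in> topspace (total E). proj E x \<in> W}" by auto
    \<comment> \<open>Compression to the corner by continuous sections. In the frame it keeps only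
      the entry at (i, j), and its norm is the modulus of that entry.\<close>
    define \<psi> where "\<psi> x = bmul E (bmul E (q i (proj E x)) x) (q j (proj E x))" for x
    have "continuous_map ?Y ?X (proj E)"
      using proj_continuous by (auto simp: continuous_map_in_subtopology continuous_map_from_subtopology)
    then have qp: "continuous_map ?Y (total E) (\<lambda>x. q i (proj E x))" for i
      using continuous_map_compose[OF _ q_cont[of i]] by (simp add: o_def)
    have "continuous_map ?Y (total E) (\<lambda>x. bmul E (q i (proj E x)) x)"
      using q by (intro continuous_map_bmul qp continuous_map_from_subtopology) (auto)
    then have \<psi>_cont: "continuous_map ?Y (total E) \<psi>"
      unfolding \<psi>_def using q by (intro continuous_map_bmul qp) (auto simp: proj_bmul)
    have \<psi>: "\<psi> x \<in> topspace (total E) \<and> proj E (\<psi> x) = proj E x \<and>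
        f (proj E x) (\<psi> x) = mat_smult (f (proj E x) x $ i $ j) (mat_unit i j) \<and>
        bnrm E (\<psi> x) = cmod (f (proj E x) x $ i $ j)" if "x \<in> topspace (total E)" "proj E x \<in> W" for x
    proof -
      interpret F: matrix_cstar_algebra "fibre E (proj E x)" "f (proj E x)" by (rule fib[OF that(2)])
      have c: "q i (proj E x) \<in> carr (fibre E (proj E x))" "q j (proj E x) \<in> carr (fibre E (proj E x))"
        "x \<in> carr (fibre E (proj E x))"
        using q that by auto
      have \<psi>c: "\<psi> x \<in> carr (fibre E (proj E x))"
        using F.mul_closed[OF F.mul_closed[OF c(1,3)] c(2)] by (simp add: \<psi>_def)
      have "f (proj E x) (\<psi> x) = mat_unit i i ** f (proj E x) x ** mat_unit j j"
        using F.h_mul[OF F.mul_closed[OF c(1,3)] c(2)] F.h_mul[OF c(1,3)] q[OF that(2)] by (simp add: \<psi>_def)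
      then have h\<psi>: "f (proj E x) (\<psi> x) = mat_smult (f (proj E x) x $ i $ j) (mat_unit i j)"
        by (simp add: mat_unit_corner)
      moreover have "bnrm E (\<psi> x) = cmod (f (proj E x) x $ i $ j)"
        using F.nrm_scaled_unit[of "f (proj E x) x $ i $ j" i j] F.k_eqI[OF \<psi>c h\<psi>] by simp
      ultimately show ?thesis using \<psi>c by simp
    qed
    \<comment> \<open>Here the compressed point can be normalized. The set contains
      \<open>x0\<close>, whose compression is \<open>x0\<close> itself, of norm 1.\<close>
    define O' where "O' = {x \<in> topspace ?Y. bnrm E (\<psi> x) \<in> - {0}}"
    have "openin ?Y O'"
      unfolding O'_def
      by (rule openin_continuous_map_preimage[OF continuous_map_bnrm[OF \<psi>_cont]]) (simp add: open_Compl flip: open_openin)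
    then have O': "openin (total E) O'"
      using Yop openin_trans_full by blast
    let ?O = "subtopology (total E) O'"
    have O'_top: "topspace ?O = O'" using openin_subset[OF O'] by auto
    define \<phi> where "\<phi> x = bsmul E (of_real (1 / bnrm E (\<psi> x))) (\<psi> x)" for x
    have \<psi>_O: "continuous_map ?O (total E) \<psi>"
      by (rule continuous_map_from_subtopology_mono[OF \<psi>_cont]) (auto simp: O'_def)
    have "continuous_map ?O euclideanreal (\<lambda>x. 1 / bnrm E (\<psi> x))"
      by (intro continuous_map_real_divide continuous_map_bnrm \<psi>_O) (auto simp: O'_def)
    then have "continuous_map ?O euclidean (\<lambda>x. complex_of_real (1 / bnrm E (\<psi> x)))"
      unfolding continuous_map_atin limitin_canonical_iff by (intro ballI tendsto_of_real) (erule (1) bspec)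
    then have "continuous_map ?O (total E) \<phi>"
      unfolding \<phi>_def by (intro continuous_map_bsmul \<psi>_O)
    then have "openin ?O {x \<in> topspace ?O. \<phi> x \<in> G}"
      by (rule openin_continuous_map_preimage[OF _ G])
    then have N: "openin (total E) {x \<in> O'. \<phi> x \<in> G}"
      unfolding O'_top using O' openin_trans_full by blast
    have x0': "x0 \<in> topspace (total E)" "proj E x0 \<in> W" using x0 by (auto simp: Z_def)
    obtain c where c: "cmod c = 1" "f (proj E x0) x0 = mat_smult c (mat_unit i j)"
      using x0 by (auto simp: Z_def)
    then have nrm1: "bnrm E (\<psi> x0) = 1" "f (proj E x0) (\<psi> x0) = f (proj E x0) x0"
      using \<psi>[OF x0'] by simp_all
    have "\<phi> x0 = x0"
    proof -
      interpret F: matrix_cstar_algebra "fibre E (proj E x0)" "f (proj E x0)" by (rule fib[OF x0'(2)])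
      have "\<psi> x0 = x0"
        using F.h_inject[of "\<psi> x0" x0] \<psi>[OF x0'] x0' nrm1(2) by simp
      then show ?thesis
        using F.one_smul[of x0] x0' nrm1 by (simp add: \<phi>_def)
    qed
    then have mem: "x0 \<in> {x \<in> O'. \<phi> x \<in> G}"
      using x0 x0' nrm1 by (simp add: O'_def)
    have "proj E x \<in> proj E ` (G \<inter> Z)" if x: "x \<in> O'" "\<phi> x \<in> G" for x
    proof -
      have xT: "x \<in> topspace (total E)" "proj E x \<in> W" and nz: "bnrm E (\<psi> x) \<noteq> 0"
        using x by (auto simp: O'_def)
      let ?c = "f (proj E x) x $ i $ j"
      have "f (proj E x) (\<phi> x) = mat_smult (of_real (1 / cmod ?c)) (mat_smult ?c (mat_unit i j))"
        using f_smul[of "\<psi> x" "of_real (1 / bnrm E (\<psi> x))"] \<psi>[OF xT] xT by (simp add: \<phi>_def)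
      also have "\<dots> = mat_smult (?c / of_real (cmod ?c)) (mat_unit i j)"
        by (simp add: vec_eq_iff)
      finally have "f (proj E x) (\<phi> x) = mat_smult (?c / of_real (cmod ?c)) (mat_unit i j)" .
      moreover have "cmod (?c / of_real (cmod ?c)) = 1"
        using nz \<psi>[OF xT] by (simp add: norm_divide)
      moreover have "\<phi> x \<in> topspace (total E)" "proj E (\<phi> x) = proj E x"
        using \<psi>[OF xT] by (simp_all add: \<phi>_def bsmul_total proj_bsmul)
      ultimately have "\<phi> x \<in> Z" "proj E (\<phi> x) = proj E x"
        using xT unfolding Z_def by auto
      then show ?thesis using x by (metis IntI imageI)
    qed
    then show ?thesis
      using N mem proj_open unfolding open_map_def by blast
  qed
  obtain V v where V: "openin ?X V" "t \<in> V" "continuous_map (subtopology ?X V) P v"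
    "\<And>y. y \<in> V \<Longrightarrow> proj E (v y) = y"
  proof (rule local_section[of ?X "proj E" t])
    show "continuous_map P ?X (proj E)"
      unfolding P_def
      by (intro continuous_map_into_subtopology continuous_map_from_subtopology proj_continuous) (auto simp: Z_def)
    show "open_map P ?X (proj E)"
      unfolding open_map_def
    proof (intro allI impI)
      fix H assume "openin P H"
      then obtain G where G: "openin (total E) G" "H = G \<inter> Z"
        by (auto simp: P_def openin_subtopology)
      have "openin (base E) (proj E ` H)"
        by (subst openin_subopen) (use open_near G in blast)
      moreover have "proj E ` H \<subseteq> W" using G by (auto simp: Z_def)
      ultimately show "openin ?X (proj E ` H)"
        by (simp add: openin_open_subtopology[OF W])
    qed
    show "proj E ` topspace P = topspace ?X"
    proof -
      have "s \<in> proj E ` Z" if s: "s \<in> W" for s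
      proof -
        interpret F: matrix_cstar_algebra "fibre E s" "f s" by (rule fib[OF s])
        have "F.k (mat_unit i j) \<in> topspace (total E)" "proj E (F.k (mat_unit i j)) = s"
          using F.k_closed[of "mat_unit i j"] by (auto simp del: F.k_closed)
        moreover have "f s (F.k (mat_unit i j)) = mat_smult 1 (mat_unit i j)"
          unfolding F.h_k by (simp add: vec_eq_iff)
        ultimately have "F.k (mat_unit i j) \<in> Z"
          using s by (auto simp: Z_def intro!: exI[of _ 1])
        then show ?thesis by (rule rev_image_eqI) (simp only: \<open>proj E (F.k (mat_unit i j)) = s\<close>)
      qed
      then show ?thesis unfolding P X by (auto simp: Z_def)
    qed
    show "locally_compact_space ?X"
      by (rule locally_compact_space_open_subset[OF _ base(1) W]) (simp add: base)
    show "Hausdorff_space ?X" by (simp add: Hausdorff_space_subtopology base)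
    show "Hausdorff_space P" by (simp add: P_def Hausdorff_space_subtopology Hausdorff_total base)
    show "proj E (bsmul E c x) = proj E x" if "x \<in> topspace P" for c x
      using that by (simp add: P Z_def proj_bsmul)
    show "\<exists>c. cmod c = 1 \<and> y = bsmul E c x" if xy: "x \<in> topspace P" "y \<in> topspace P" "proj E x = proj E y" for x y
    proof -
      have T: "x \<in> topspace (total E)" "y \<in> topspace (total E)" "proj E y \<in> W"
        using xy by (auto simp: P Z_def)
      interpret F: matrix_cstar_algebra "fibre E (proj E y)" "f (proj E y)" by (rule fib[OF T(3)])
      obtain c d where c: "cmod c = 1" "f (proj E y) x = mat_smult c (mat_unit i j)"
        and d: "cmod d = 1" "f (proj E y) y = mat_smult d (mat_unit i j)"
        using xy by (auto simp: P Z_def)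
      have "c \<noteq> 0" using c by auto
      have "f (proj E y) (bsmul E (d / c) x) = f (proj E y) y"
        using f_smul[of x "d / c"] T xy(3) c d \<open>c \<noteq> 0\<close> by (simp add: vec_eq_iff)
      then have "bsmul E (d / c) x = y"
        using F.h_inject[of "bsmul E (d / c) x" y] T xy(3) by (simp add: bsmul_total proj_bsmul)
      then show ?thesis using c d by (intro exI[of _ "d / c"]) (simp add: norm_divide)
    qed
    show "c = 1" if x: "x \<in> topspace P" "bsmul E c x = x" for c x
    proof -
      obtain d where d: "cmod d = 1" "f (proj E x) x = mat_smult d (mat_unit i j)"
        using x by (auto simp: P Z_def)
      have "mat_smult c (f (proj E x) x) = f (proj E x) x"
        using f_smul[of x c] x by (simp add: P Z_def)
      then have "mat_smult c (f (proj E x) x) $ i $ j = f (proj E x) x $ i $ j"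
        by simp
      then show ?thesis using d by auto
    qed
    show "t \<in> topspace ?X" using t X by simp
  qed blast
  have VW: "V \<subseteq> W" using openin_subset[OF V(1)] X by simp
  then have sub: "subtopology ?X V = subtopology (base E) V"
    by (simp add: subtopology_subtopology inf_absorb2)
  show ?thesis
  proof
    show "openin (base E) V" using V(1) W openin_trans_full by blast
    show "continuous_map (subtopology (base E) V) (total E) v"
      using V(3) unfolding sub by (simp add: P_def continuous_map_in_subtopology)
    show "v s \<in> topspace (total E) \<and> proj E (v s) = s \<and>
      (\<exists>c. cmod c = 1 \<and> f s (v s) = mat_smult c (mat_unit i j))" if s: "s \<in> V" for s
    proof -
      have "v s \<in> Z"
        using continuous_map_funspace[OF V(3)] s openin_subset[OF V(1)] P by auto
      then show ?thesis using V(4)[OF s] by (auto simp: Z_def)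
    qed
  qed (use V VW in auto)
qed

end


section \<open>Trivialization\<close>

text \<open>The frames \<open>f s\<close> may jump, but the continuous sections \<open>w i\<close>
  tie them down: the entries of \<open>f s x\<close> and the inverse of \<open>f s\<close> can both
  be expressed by the sections and the bundle operations.\<close>

lemma (in cstar_bundle) trivialization:
  fixes f :: "'t \<Rightarrow> 'e \<Rightarrow> complex^'n^'n" and w :: "'n \<Rightarrow> 't \<Rightarrow> 'e"
  assumes W: "openin (base E) W" and frame: "\<And>s. s \<in> W \<Longrightarrow> star_iso (fibre E s) matrix_alg (f s)"
    and w_cont: "\<And>i. continuous_map (subtopology (base E) W) (total E) (w i)"
    and w: "\<And>i s. s \<in> W \<Longrightarrow> w i s \<in> topspace (total E) \<and> proj E (w i s) = s \<and> f s (w i s) = mat_unit i o'"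
  shows "bundle_iso (bundle_restrict E W) (trivial_bundle (subtopology (base E) W) matrix_alg)
    (\<lambda>x. (proj E x, f (proj E x) x))"
proof -
  let ?\<phi> = "\<lambda>x. (proj E x, f (proj E x) x)"
  have W_base: "W \<subseteq> topspace (base E)" using W openin_subset by blast
  have fib: "matrix_cstar_algebra (fibre E s) (f s)" if "s \<in> W" for s
    using that W_base by (auto simp: matrix_cstar_algebra_def matrix_cstar_algebra_axioms_def fibre_cstar frame)
  let ?X = "subtopology (base E) W"
  let ?Y = "subtopology (total E) {x. proj E x \<in> W}"
  let ?T = "prod_topology ?X (euclidean :: (complex^'n^'n) topology)"
  have X: "topspace ?X = W" using W_base by auto
  have Y: "topspace ?Y = {x \<in> topspace (total E). proj E x \<in> W}" by auto
  have proj_Y: "continuous_map ?Y ?X (proj E)"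
    by (intro continuous_map_into_subtopology continuous_map_from_subtopology proj_continuous) auto
  have wp: "continuous_map ?Y (total E) (\<lambda>x. w i (proj E x))" for i
    using continuous_map_compose[OF proj_Y w_cont[of i]] by (simp add: o_def)
  let ?k = "\<lambda>s. matrix_cstar_algebra.k (fibre E s) (f s)"
  have k: "?k s M \<in> topspace (total E)" "proj E (?k s M) = s" "f s (?k s M) = M" if "s \<in> W" for s M
  proof -
    interpret F: matrix_cstar_algebra "fibre E s" "f s" by (rule fib[OF that])
    show "?k s M \<in> topspace (total E)" "proj E (?k s M) = s" "f s (?k s M) = M"
      using F.k_closed[of M] F.h_k[of M] by (auto simp del: F.k_closed)
  qed
  have kf: "?k (proj E x) (f (proj E x) x) = x" if "x \<in> topspace ?Y" for x
  proof -
    interpret F: matrix_cstar_algebra "fibre E (proj E x)" "f (proj E x)" using that by (simp add: fib Y)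
    show ?thesis using that F.k_h[of x] by simp
  qed

  text \<open>The entry \<open>f x\<^sub>i\<^sub>j\<close> is detected by the norm of \<open>w\<^sub>i\<^sup>* x w\<^sub>j - c e\<close>, where \<open>e\<close> is the unit
    \<open>w\<^sub>o\<^sup>* w\<^sub>o\<close>, hence depends continuously on \<open>x\<close>.\<close>
  define D where "D i j c x = bsub E (bmul E (bmul E (badj E (w i (proj E x))) x) (w j (proj E x)))
      (bsmul E c (bmul E (badj E (w o' (proj E x))) (w o' (proj E x))))" for i j c x
  have D_cont: "continuous_map ?Y (total E) (D i j c)" for i j c
  proof -
    have "continuous_map ?Y (total E) (\<lambda>x. bmul E (badj E (w i (proj E x))) x)"
      by (rule continuous_map_bmul[OF continuous_map_badj[OF wp]]) (auto simp: w proj_badj continuous_map_from_subtopology)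
    then have 1: "continuous_map ?Y (total E) (\<lambda>x. bmul E (bmul E (badj E (w i (proj E x))) x) (w j (proj E x)))"
      by (rule continuous_map_bmul[OF _ wp]) (auto simp: w proj_badj proj_bmul badj_total)
    have "continuous_map ?Y (total E) (\<lambda>x. bmul E (badj E (w o' (proj E x))) (w o' (proj E x)))"
      by (rule continuous_map_bmul[OF continuous_map_badj[OF wp] wp]) (auto simp: w proj_badj)
    then have 2: "continuous_map ?Y (total E) (\<lambda>x. bsmul E c (bmul E (badj E (w o' (proj E x))) (w o' (proj E x))))"
      by (rule continuous_map_bsmul[rotated]) simp
    show ?thesis
      unfolding D_def
      by (rule continuous_map_bsub[OF 1 2]) (auto simp: w proj_badj proj_bmul badj_total bmul_total proj_bsmul)
  qed
  have D_nrm: "bnrm E (D i j c x) = cmod (f (proj E x) x $ i $ j - c)" if x: "x \<in> topspace ?Y" for i j c x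
  proof -
    let ?s = "proj E x"
    have s: "?s \<in> W" using x by simp
    interpret F: matrix_cstar_algebra "fibre E ?s" "f ?s" by (rule fib[OF s])
    have xc: "x \<in> carr (fibre E ?s)" and wc: "w l ?s \<in> carr (fibre E ?s)" for l
      using x w[OF s] by auto
    have wa: "badj E (w l ?s) \<in> carr (fibre E ?s)" for l
      using F.adj_closed[OF wc] by simp
    have fa: "f ?s (badj E (w l ?s)) = mat_unit o' l" for l
      using F.h_adj[OF wc] w[OF s] by simp
    have c1: "bmul E (badj E (w i ?s)) x \<in> carr (fibre E ?s)"
      using F.mul_closed[OF wa xc] by simp
    have c2: "bmul E (bmul E (badj E (w i ?s)) x) (w j ?s) \<in> carr (fibre E ?s)"
      using F.mul_closed[OF c1 wc] by simp
    have c3: "bmul E (badj E (w o' ?s)) (w o' ?s) \<in> carr (fibre E ?s)"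
      using F.mul_closed[OF wa wc] by simp
    have c4: "bsmul E c (bmul E (badj E (w o' ?s)) (w o' ?s)) \<in> carr (fibre E ?s)"
      using F.smul_closed[OF c3] by simp
    have "f ?s (bmul E (bmul E (badj E (w i ?s)) x) (w j ?s)) = mat_unit o' i ** f ?s x ** mat_unit j o'"
      using F.h_mul[OF c1 wc] F.h_mul[OF wa xc] fa w[OF s] by simp
    moreover have "f ?s (bsmul E c (bmul E (badj E (w o' ?s)) (w o' ?s))) = mat_smult c (mat_unit o' o')"
      using F.h_smul[OF c3] F.h_mul[OF wa wc] fa w[OF s] by (simp add: mat_unit_mul_mat_unit)
    ultimately have "f ?s (D i j c x) = mat_unit o' i ** f ?s x ** mat_unit j o' - mat_smult c (mat_unit o' o')"
      using F.h_sub[OF c2 c4] by (simp add: D_def)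
    also have "\<dots> = mat_smult (f ?s x $ i $ j - c) (mat_unit o' o')"
      by (rule mat_eqI) (simp add: mul_mat_unit_nth mat_unit_mul_nth mat_unit_nth)
    finally have "f ?s (D i j c x) = mat_smult (f ?s x $ i $ j - c) (mat_unit o' o')" .
    moreover have "D i j c x \<in> carr (fibre E ?s)"
      using F.sub_closed[OF c2 c4] by (simp add: D_def)
    ultimately show ?thesis
      using F.nrm_scaled_unit[of "f ?s x $ i $ j - c" o' o'] F.k_eqI by simp
  qed
  have f_cont: "continuous_map ?Y euclidean (\<lambda>x. f (proj E x) x)"
    unfolding continuous_map_atin limitin_canonical_iff
  proof (intro ballI vec_tendstoI)
    fix y i j assume y: "y \<in> topspace ?Y"
    let ?c = "f (proj E y) y $ i $ j"
    have "continuous_map ?Y euclideanreal (\<lambda>x. bnrm E (D i j ?c x))"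
      by (rule continuous_map_bnrm[OF D_cont])
    then have "continuous_map ?Y euclideanreal (\<lambda>x. cmod (f (proj E x) x $ i $ j - ?c))"
      by (rule continuous_map_eq) (rule D_nrm)
    then have "((\<lambda>x. cmod (f (proj E x) x $ i $ j - ?c)) \<longlongrightarrow> cmod (?c - ?c)) (atin ?Y y)"
      using y unfolding continuous_map_atin limitin_canonical_iff by (rule bspec)
    then have "((\<lambda>x. f (proj E x) x $ i $ j - ?c) \<longlongrightarrow> 0) (atin ?Y y)"
      by (simp add: tendsto_norm_zero_iff)
    then show "((\<lambda>x. f (proj E x) x $ i $ j) \<longlongrightarrow> ?c) (atin ?Y y)"
      by (simp add: LIM_zero_iff)
  qed

  \<comment> \<open>The inverse is the sum over all positions of the entry times the corresponding
    matrix unit. It is built by induction on a finite set \<open>K\<close> of positions, with all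
    other entries set to zero.\<close>
  have k_cont: "continuous_map ?T (total E) (\<lambda>p. ?k (fst p) (\<chi> i j. if (i, j) \<in> K then snd p $ i $ j else 0))"
    (is "continuous_map _ _ (?K K)") if "finite K" for K
    using that
  proof (induction K)
    case empty
    \<comment> \<open>The zero section, written as 0 times a continuous section so that continuity
      comes from scalar multiplication.\<close>
    have "continuous_map ?T (total E) (\<lambda>p. bsmul E 0 (w o' (fst p)))"
      using continuous_map_compose[OF continuous_map_fst w_cont[of o']]
      by (intro continuous_map_bsmul) (simp_all add: o_def)
    then show ?case
    proof (rule continuous_map_eq)
      fix p assume "p \<in> topspace ?T"
      then have s: "fst p \<in> W" by auto
      interpret F: matrix_cstar_algebra "fibre E (fst p)" "f (fst p)" by (rule fib[OF s])
      have wc: "w o' (fst p) \<in> carr (fibre E (fst p))" using w[OF s] by simp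
      show "bsmul E 0 (w o' (fst p)) = ?K {} p"
        using F.smul_closed[OF wc, of 0] F.h_smul[OF wc, of 0]
        by (intro F.k_eqI[symmetric]) (simp_all add: vec_eq_iff)
    qed
  next
    case (insert a K)
    obtain i j where a: "a = (i, j)" by (cases a)
    \<comment> \<open>The frame sends this to the unit at (i, o') times the unit at (o', j), that
      is, to the unit at (i, j).\<close>
    let ?e = "\<lambda>s. bmul E (w i s) (badj E (w j s))"
    have ws: "continuous_map ?T (total E) (\<lambda>p. w i (fst p))" for i
      using continuous_map_compose[OF continuous_map_fst w_cont[of i]] by (simp add: o_def)
    have TW: "fst p \<in> W" if "p \<in> topspace ?T" for p using that by auto
    have "continuous_map ?T (total E) (\<lambda>p. ?e (fst p))"
      using TW by (intro continuous_map_bmul continuous_map_badj ws) (simp add: w proj_badj)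
    moreover have "continuous_map ?T euclidean (\<lambda>p. snd p $ i $ j)"
      using continuous_map_snd[of ?X "euclidean :: (complex^'n^'n) topology"]
      unfolding continuous_map_atin limitin_canonical_iff by (intro ballI tendsto_vec_nth) (erule (1) bspec)
    ultimately have 1: "continuous_map ?T (total E) (\<lambda>p. bsmul E (snd p $ i $ j) (?e (fst p)))"
      by (intro continuous_map_bsmul)
    have e: "?e s \<in> topspace (total E)" "proj E (?e s) = s" if "s \<in> W" for s
      using w[OF that] by (simp_all add: bmul_total proj_bmul badj_total proj_badj)
    have "continuous_map ?T (total E) (\<lambda>p. badd E (bsmul E (snd p $ i $ j) (?e (fst p))) (?K K p))"
      using TW by (intro continuous_map_badd 1 insert.IH) (simp add: e proj_bsmul k)
    then show ?case
    proof (rule continuous_map_eq)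
      fix p assume "p \<in> topspace ?T"
      then have s: "fst p \<in> W" by auto
      let ?s = "fst p"
      interpret F: matrix_cstar_algebra "fibre E ?s" "f ?s" by (rule fib[OF s])
      have wc: "w l ?s \<in> carr (fibre E ?s)" for l using w[OF s] by simp
      have wa: "badj E (w l ?s) \<in> carr (fibre E ?s)" for l using F.adj_closed[OF wc] by simp
      have ec: "?e ?s \<in> carr (fibre E ?s)" using e[OF s] by simp
      have se: "bsmul E (snd p $ i $ j) (?e ?s) \<in> carr (fibre E ?s)"
        using F.smul_closed[OF ec] by simp
      have kc: "?K K p \<in> carr (fibre E ?s)" by (rule F.k_closed)
      have "f ?s (?e ?s) = mat_unit i j"
        using F.h_mul[OF wc wa] F.h_adj[OF wc] w[OF s] by (simp add: mat_unit_mul_mat_unit)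
      then have "f ?s (badd E (bsmul E (snd p $ i $ j) (?e ?s)) (?K K p))
          = mat_smult (snd p $ i $ j) (mat_unit i j) + (\<chi> i j. if (i, j) \<in> K then snd p $ i $ j else 0)"
        using F.h_add[OF se kc] F.h_smul[OF ec] k(3)[OF s] by simp
      also have "\<dots> = (\<chi> i j. if (i, j) \<in> insert a K then snd p $ i $ j else 0)"
        using insert(2) by (auto simp: vec_eq_iff mat_unit_nth a)
      finally show "badd E (bsmul E (snd p $ i $ j) (?e ?s)) (?K K p) = ?K (insert a K) p"
        using F.add_closed[OF se kc] by (intro F.k_eqI[symmetric]) simp_all
    qed
  qed
  have "?K UNIV = (\<lambda>p. ?k (fst p) (snd p))" by simp
  then have k_cont: "continuous_map ?T (total E) (\<lambda>p. ?k (fst p) (snd p))"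
    using k_cont[of UNIV] by simp

  have hom: "homeomorphic_maps ?Y ?T ?\<phi> (\<lambda>p. ?k (fst p) (snd p))"
    unfolding homeomorphic_maps_def
  proof (intro conjI ballI)
    show "continuous_map ?Y ?T ?\<phi>"
      using proj_Y f_cont by (simp add: continuous_map_paired)
    show "continuous_map ?T ?Y (\<lambda>p. ?k (fst p) (snd p))"
      by (rule continuous_map_into_subtopology[OF k_cont]) (auto simp: k)
    show "?k (fst (?\<phi> x)) (snd (?\<phi> x)) = x" if "x \<in> topspace ?Y" for x
      using kf[OF that] by simp
    show "?\<phi> (?k (fst p) (snd p)) = p" if "p \<in> topspace ?T" for p
    proof -
      have "fst p \<in> W" using that by auto
      then show ?thesis by (simp add: k)
    qed
  qed
  let ?T' = "trivial_bundle ?X matrix_alg :: ('t, 't \<times> (complex^'n^'n)) star_bundle"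
  have total': "total ?T' = ?T" by (simp add: trivial_bundle_def matrix_alg_def)
  have iso: "star_iso (fibre (bundle_restrict E W) s) (fibre ?T' s) ?\<phi>" if s: "s \<in> W" for s
  proof -
    interpret F: matrix_cstar_algebra "fibre E s" "f s" by (rule fib[OF s])
    have carrs: "carr (fibre (bundle_restrict E W) s) = carr (fibre E s)"
      "carr (fibre ?T' s) = {s} \<times> UNIV"
      using s W_base unfolding fibre_simps(1) total' by (auto simp: bundle_restrict_def trivial_bundle_def)
    have "bij_betw (\<lambda>x. (s, f s x)) (carr (fibre E s)) ({s} \<times> UNIV)"
      using F.h_bij by (auto simp: bij_betw_def inj_on_def image_iff)
    then have "bij_betw ?\<phi> (carr (fibre E s)) ({s} \<times> UNIV)"
      by (rule bij_betw_cong[THEN iffD1, rotated]) simp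
    then show ?thesis
      unfolding star_iso_def carrs
      using F.h_add F.h_smul F.h_mul F.h_adj F.add_closed F.mul_closed F.smul_closed F.adj_closed
      by (auto simp: bundle_restrict_def trivial_bundle_def matrix_alg_def mat_smult_def mat_adj_def)
  qed
  show ?thesis
    unfolding bundle_iso_def
  proof (intro conjI ballI)
    show "homeomorphic_map (total (bundle_restrict E W)) (total ?T') ?\<phi>"
      using hom unfolding total' homeomorphic_map_maps by (auto simp: bundle_restrict_def)
    show "star_iso (fibre (bundle_restrict E W) s) (fibre ?T' s) ?\<phi>"
      if "s \<in> topspace (base (bundle_restrict E W))" for s
      using that by (intro iso) (simp add: bundle_restrict_def)
  qed (simp_all add: bundle_restrict_def trivial_bundle_def)
qed

section \<open>Assembly: compatible frames, idempotents and phases\<close>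

theorem lemma2p1:
  fixes T :: "'t topology"
    and \<A> :: "('t, 'e) star_bundle"
    and \<B> :: "'e set"
    and A :: "('t \<Rightarrow> 'e) star_alg"
    and B :: "('t \<Rightarrow> 'e) set"
  assumes "locally_compact_space T" and "Hausdorff_space T"
    and "cstar_bundle \<A>" and "base \<A> = T"
    and "\<forall>t\<in>topspace T. star_isomorphic (fibre \<A> t) (matrix_alg :: (complex^'n^'n) star_alg)"
    and "A = section_alg \<A>"
    and "cartan_subalgebra A B"
    and "sub_cstar_bundle \<A> \<B>"
    and "\<forall>t\<in>topspace T.
           star_isomorphic (fibre (subbundle \<A> \<B>) t) (diagonal_alg :: (complex^'n^'n) star_alg)"
    and "B = sections (subbundle \<A> \<B>)"
  shows "\<forall>t\<in>topspace T. \<exists>W \<phi>. openin T W \<and> t \<in> W \<and>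
           bundle_iso (bundle_restrict \<A> W)
             (trivial_bundle (subtopology T W) (matrix_alg :: (complex^'n^'n) star_alg)) \<phi> \<and>
           \<phi> ` (\<B> \<inter> {x. proj \<A> x \<in> W}) = W \<times> diagonal"
proof
  fix t assume t: "t \<in> topspace T"
  interpret \<A>: cstar_bundle \<A> by fact
  interpret \<B>: cstar_bundle "subbundle \<A> \<B>"
    using assms by (simp add: sub_cstar_bundle_def)
  have \<B>_total: "\<B> \<subseteq> topspace (total \<A>)"
    using assms by (simp add: sub_cstar_bundle_def)
  \<comment> \<open>The isomorphisms given for a fibre of the bundle and of the sub-bundle are
    unrelated; \<open>diagonalizing_iso\<close> replaces the former by one that carries the fibre of
    \<open>\<B>\<close> onto the diagonal matrices.\<close>
  have "\<forall>s\<in>topspace T. \<exists>h :: 'e \<Rightarrow> complex^'n^'n. star_iso (fibre \<A> s) matrix_alg h \<and>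
      h ` {x \<in> \<B>. proj \<A> x = s} = diagonal"
  proof
    fix s assume s: "s \<in> topspace T"
    interpret F: cstar_algebra "fibre \<A> s"
      using s assms by (simp add: \<A>.fibre_cstar)
    let ?B = "{x \<in> topspace (total \<A>). x \<in> \<B> \<and> proj \<A> x = s}"
    have sub: "fibre (subbundle \<A> \<B>) s = (fibre \<A> s)\<lparr>carr := ?B\<rparr>"
      by (rule fibre_subbundle)
    have "cstar_algebra (fibre (subbundle \<A> \<B>) s)"
      using s assms by (intro \<B>.fibre_cstar) (simp add: subbundle_def)
    then have subalg: "cstar_subalgebra (fibre \<A> s) ?B"
      unfolding cstar_subalgebra_def sub by auto
    obtain h :: "'e \<Rightarrow> complex^'n^'n" where h: "star_iso (fibre \<A> s) matrix_alg h"
      using assms(5) s unfolding star_isomorphic_def by blast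
    obtain g :: "'e \<Rightarrow> complex^'n^'n" where g: "star_iso ((fibre \<A> s)\<lparr>carr := ?B\<rparr>) diagonal_alg g"
      using assms(9)[rule_format, OF s] unfolding star_isomorphic_def sub by blast
    obtain f :: "'e \<Rightarrow> complex^'n^'n" where "star_iso (fibre \<A> s) matrix_alg f" "f ` ?B = diagonal"
      by (rule F.diagonalizing_iso[OF h subalg g])
    moreover have "?B = {x \<in> \<B>. proj \<A> x = s}" using \<B>_total by auto
    ultimately show "\<exists>h :: 'e \<Rightarrow> complex^'n^'n. star_iso (fibre \<A> s) matrix_alg h \<and>
        h ` {x \<in> \<B>. proj \<A> x = s} = diagonal" by auto
  qed
  from bchoice[OF this] obtain h :: "'t \<Rightarrow> 'e \<Rightarrow> complex^'n^'n" where
    h: "\<forall>s\<in>topspace T. star_iso (fibre \<A> s) matrix_alg (h s) \<and> h s ` {x \<in> \<B>. proj \<A> x = s} = diagonal"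
    by blast
  interpret framed_bundle \<A> \<B> h
    by unfold_locales (use assms h in auto)
  have t': "t \<in> topspace (base \<A>)" using t assms by simp
  obtain W and q :: "'n \<Rightarrow> 't \<Rightarrow> 'e" and f :: "'t \<Rightarrow> 'e \<Rightarrow> complex^'n^'n"
    where W: "openin (base \<A>) W" "t \<in> W"
      and q_cont: "\<And>i. continuous_map (subtopology (base \<A>) W) (total \<A>) (q i)"
      and q: "\<And>i s. s \<in> W \<Longrightarrow> q i s \<in> topspace (total \<A>) \<and> proj \<A> (q i s) = s \<and> f s (q i s) = mat_unit i i"
      and f: "\<And>s. s \<in> W \<Longrightarrow> star_iso (fibre \<A> s) matrix_alg (f s)"
      and f_sub: "\<And>s. s \<in> W \<Longrightarrow> f s ` {x \<in> \<B>. proj \<A> x = s} = diagonal"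
    using local_diagonal_frame[OF t'] by blast
  \<comment> \<open>Any index does: it names the column of matrix units to be constructed.\<close>
  define o' :: 'n where "o' = undefined"
  have "\<forall>i. \<exists>V v. openin (base \<A>) V \<and> t \<in> V \<and> V \<subseteq> W \<and> continuous_map (subtopology (base \<A>) V) (total \<A>) v \<and>
      (\<forall>s\<in>V. v s \<in> topspace (total \<A>) \<and> proj \<A> (v s) = s \<and>
        (\<exists>c. cmod c = 1 \<and> f s (v s) = mat_smult c (mat_unit i o')))"
  proof
    fix i
    show "\<exists>V v. openin (base \<A>) V \<and> t \<in> V \<and> V \<subseteq> W \<and> continuous_map (subtopology (base \<A>) V) (total \<A>) v \<and>
      (\<forall>s\<in>V. v s \<in> topspace (total \<A>) \<and> proj \<A> (v s) = s \<and>
        (\<exists>c. cmod c = 1 \<and> f s (v s) = mat_smult c (mat_unit i o')))"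
      by (rule \<A>.normalized_section[OF _ _ W(1) f q_cont q W(2), of i o']) (use assms in \<open>auto 0 3\<close>)
  qed
  from choice[OF this] obtain V where "\<forall>i. \<exists>v. openin (base \<A>) (V i) \<and> t \<in> V i \<and> V i \<subseteq> W \<and>
      continuous_map (subtopology (base \<A>) (V i)) (total \<A>) v \<and>
      (\<forall>s\<in>V i. v s \<in> topspace (total \<A>) \<and> proj \<A> (v s) = s \<and>
        (\<exists>c. cmod c = 1 \<and> f s (v s) = mat_smult c (mat_unit i o')))" by blast
  from choice[OF this] obtain v where V: "\<And>i. openin (base \<A>) (V i)" "\<And>i. t \<in> V i" "\<And>i. V i \<subseteq> W"
    and v_cont: "\<And>i. continuous_map (subtopology (base \<A>) (V i)) (total \<A>) (v i)"
    and v: "\<And>i s. s \<in> V i \<Longrightarrow> v i s \<in> topspace (total \<A>) \<and> proj \<A> (v i s) = s \<and>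
        (\<exists>c. cmod c = 1 \<and> f s (v i s) = mat_smult c (mat_unit i o'))"
    by blast
  define U where "U = (\<Inter>i. V i)"
  have "openin (base \<A>) U"
    unfolding U_def by (intro openin_INT2 V) auto
  moreover have "t \<in> U" "U \<subseteq> V o'" using V by (auto simp: U_def)
  ultimately have U: "openin (base \<A>) U" "t \<in> U" "U \<subseteq> W" using V(3)[of o'] by auto
  have v_cont: "continuous_map (subtopology (base \<A>) U) (total \<A>) (v i)" for i
    by (rule continuous_map_from_subtopology_mono[OF v_cont]) (auto simp: U_def)
  have "\<exists>l. \<forall>i. cmod (l i) = 1 \<and> f s (v i s) = mat_smult (l i) (mat_unit i o')" if "s \<in> U" for s
    by (rule choice) (use v that in \<open>auto simp: U_def\<close>)
  then have "\<forall>s\<in>U. \<exists>l. \<forall>i. cmod (l i) = 1 \<and> f s (v i s) = mat_smult (l i) (mat_unit i o')" by blast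
  from bchoice[OF this] obtain l where l: "\<And>s i. s \<in> U \<Longrightarrow> cmod (l s i) = 1"
    and fv: "\<And>s i. s \<in> U \<Longrightarrow> f s (v i s) = mat_smult (l s i) (mat_unit i o')" by blast
  have v: "v i s \<in> topspace (total \<A>)" "proj \<A> (v i s) = s" if "s \<in> U" for i s
    using v that by (auto simp: U_def)
  \<comment> \<open>\<open>f\<close> sends \<open>v i\<close> to a matrix unit only up to a phase
    \<open>l s i\<close>, which need not depend continuously on \<open>s\<close>. Conjugation by the
    diagonal unitary of these phases absorbs them into the frame.\<close>
  define g :: "'t \<Rightarrow> 'e \<Rightarrow> complex^'n^'n"
    where "g s x = (\<chi> i j. cnj (l s i) * f s x $ i $ j * l s j)" for s x
  have g: "star_iso (fibre \<A> s) matrix_alg (g s)" if "s \<in> U" for s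
    unfolding g_def by (rule star_iso_phase) (use f l that U in auto)
  \<comment> \<open>\<open>g\<close> sends \<open>v i\<close> to \<open>l s o'\<close> times the
    unit at (i, o'), so one common phase is left; the adjoint of \<open>v o'\<close> cancels
    it.\<close>
  define w where "w i s = bmul \<A> (v i s) (badj \<A> (v o' s))" for i s
  have ll: "cnj (l s i) * l s i = 1" if "s \<in> U" for s i
    using l[OF that, of i] complex_norm_square[of "l s i"] by (simp add: mult.commute)
  have gw: "g s (w i s) = mat_unit i o'" if s: "s \<in> U" for i s
  proof -
    interpret F: matrix_cstar_algebra "fibre \<A> s" "f s"
      using s U W(1) openin_subset
      by (auto simp: matrix_cstar_algebra_def matrix_cstar_algebra_axioms_def intro!: f \<A>.fibre_cstar)
    have c: "v i s \<in> carr (fibre \<A> s)" for i using v[OF s] by simp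
    have a: "badj \<A> (v o' s) \<in> carr (fibre \<A> s)" using F.adj_closed[OF c] by simp
    have "f s (w i s) = mat_smult (l s i) (mat_unit i o') ** mat_adj (mat_smult (l s o') (mat_unit o' o'))"
      using F.h_mul[OF c a] F.h_adj[OF c] by (simp add: w_def fv[OF s])
    also have "mat_adj (mat_smult (l s o') (mat_unit o' o')) = mat_smult (cnj (l s o')) (mat_unit o' o')"
      by (simp add: vec_eq_iff mat_unit_nth)
    finally have "f s (w i s) = mat_smult (l s i * cnj (l s o')) (mat_unit i o')"
      by (simp add: mat_smult_mul mul_mat_smult mat_unit_mul_mat_unit vec_eq_iff)
    then have "g s (w i s) $ a $ b = (cnj (l s i) * l s i) * (cnj (l s o') * l s o') * mat_unit i o' $ a $ b" for a b
      by (auto simp: g_def mat_unit_nth)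
    then show ?thesis by (simp add: ll[OF s] mat_eqI)
  qed
  have w: "w i s \<in> topspace (total \<A>) \<and> proj \<A> (w i s) = s \<and> g s (w i s) = mat_unit i o'" if "s \<in> U" for i s
    using v[OF that] gw[OF that] by (simp add: w_def \<A>.bmul_total \<A>.proj_bmul \<A>.badj_total \<A>.proj_badj)
  have w_cont: "continuous_map (subtopology (base \<A>) U) (total \<A>) (w i)" for i
    unfolding w_def by (intro \<A>.continuous_map_bmul \<A>.continuous_map_badj v_cont) (simp add: v \<A>.proj_badj)
  \<comment> \<open>The phases are nonzero, so \<open>g\<close> and \<open>f\<close> have the same
    vanishing entries and the fibres of \<open>\<B>\<close> still go to the diagonal.\<close>
  have g_diag: "g s x \<in> diagonal \<longleftrightarrow> f s x \<in> diagonal" if "s \<in> U" for s x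
  proof -
    have "l s i \<noteq> 0" for i using l[OF that, of i] by auto
    then show ?thesis by (simp add: diagonal_def g_def)
  qed
  let ?\<phi> = "\<lambda>x. (proj \<A> x, g (proj \<A> x) x)"
  have "bundle_iso (bundle_restrict \<A> U) (trivial_bundle (subtopology T U) matrix_alg) ?\<phi>"
    using \<A>.trivialization[OF U(1) g w_cont w] assms(4) by simp
  moreover have "?\<phi> ` (\<B> \<inter> {x. proj \<A> x \<in> U}) = U \<times> diagonal"
  proof
    show "?\<phi> ` (\<B> \<inter> {x. proj \<A> x \<in> U}) \<subseteq> U \<times> diagonal"
      using f_sub U g_diag by blast
    show "U \<times> diagonal \<subseteq> ?\<phi> ` (\<B> \<inter> {x. proj \<A> x \<in> U})"
    proof clarify
      fix s and M :: "complex^'n^'n" assume s: "s \<in> U" and M: "M \<in> diagonal"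
      \<comment> \<open>\<open>g s x\<close> depends on \<open>x\<close> only through
        \<open>f s x\<close>, so \<open>x\<close> can be replaced by a point of \<open>\<B>\<close>
        with the same image under \<open>f s\<close>.\<close>
      obtain x where x: "x \<in> carr (fibre \<A> s)" "g s x = M"
        using g[OF s] unfolding star_iso_matrix_alg_iff bij_betw_def by (metis UNIV_I imageE)
      then have "f s x \<in> f s ` {x \<in> \<B>. proj \<A> x = s}"
        using f_sub[of s] g_diag[OF s, of x] M s U by auto
      then obtain y where y: "y \<in> \<B>" "proj \<A> y = s" "f s x = f s y" by blast
      then have "g s y = M" using x by (simp add: g_def)
      then show "(s, M) \<in> ?\<phi> ` (\<B> \<inter> {x. proj \<A> x \<in> U})"
        using y s by force
    qed
  qed
  ultimately show "\<exists>W \<phi>. openin T W \<and> t \<in> W \<and>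
           bundle_iso (bundle_restrict \<A> W)
             (trivial_bundle (subtopology T W) (matrix_alg :: (complex^'n^'n) star_alg)) \<phi> \<and>
           \<phi> ` (\<B> \<inter> {x. proj \<A> x \<in> W}) = W \<times> diagonal"
    using U assms(4) by blast
qed

end
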